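(* Let $n\ge 1$, let $0=t_0<t_1<\dots<t_n=1$, let $W_0,W_1,\dots,W_n\in\mathbb{R}$ with $W_0=W_n=0$, and let $\gamma:[0,1]\to\mathbb{R}$ be the piecewise linear interpolation of the points $(t_k,W_k)$. Let $\mathcal{U}=\{x+iy : 0<x<1,\ y<\gamma(x)\}$, let $\Gamma=\{x+i\gamma(x) : 0\le x\le 1\}$, and for $z\in\mathcal{U}$ let $\widetilde{\omega}(\cdot,\Gamma,z)$ be the hitting distribution on $\Gamma$ of the reflected Brownian motion in the strip $0\le \mathrm{Re}\le 1$ started at $z$ (as defined in the context). Let $\mathbb{H}^+=\{x+iy : x\in\mathbb{R},\ y>0\}$. Consider the unique conformal bijection $\varphi:\mathbb{H}^+\to\mathcal{U}$ whose continuous extension to the boundaries (a homeomorphism from $\mathbb{H}^+\cup\mathbb{R}\cup\{\infty\}$ onto the closure of $\mathcal{U}$ in $\mathbb{C}\cup\{\infty\}$) maps $\infty$ to $\infty$ and maps $[0,1]$ bijectively onto $\Gamma$. Then, as $|z|\to\infty$ with $z\in\mathcal{U}$, the measures $\widetilde{\omega}(\cdot,\Gamma,z)$ converge weakly to the measure $\widetilde{\omega}(\cdot,\Gamma,\infty)$ on Borel subsets of $\Gamma$ given by $$\widetilde{\omega}(E,\Gamma,\infty)=\frac{1}{\pi}\int_0^1\frac{\mathbf{1}_E(\varphi(x))}{\sqrt{x(1-x)}}\,dx$$ for every Borel set $E\subseteq\Gamma$.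
   Context: The interpolating function is $$\gamma(t)=\sum_{k=1}^n \mathbf{1}_{(t_{k-1},t_k]}(t)\left(\frac{t_k-t}{t_k-t_{k-1}}W_{k-1}+\frac{t-t_{k-1}}{t_k-t_{k-1}}W_k\right),\qquad t\in[0,1].$$ Let $(B_t)_{t\ge 0}$ be a two-dimensional Brownian motion, viewed as running in $\mathbb{C}$. The reflected Brownian motion constrained to the strip $\{0\le\mathrm{Re}\le 1\}$ is $$\mathcal{R}(B_t)=\pi^{-1}\cos^{-1}\big(\cos(\pi\,\mathrm{Re}(B_t))\big)+i\,\mathrm{Im}(B_t),$$ where $\cos^{-1}:[-1,1]\to[0,\pi]$. The hitting time of $\Gamma$ is $\widetilde{\tau}(\Gamma)=\min\{t : \mathcal{R}(B_t)\in\Gamma\}$. For $z\in\mathcal{U}$, the measure $\widetilde{\omega}(\cdot,\Gamma,z)$ on Borel subsets $E$ of $\Gamma$ is $$\widetilde{\omega}(E,\Gamma,z)=\mathbf{P}\big(\mathcal{R}(B_{\widetilde{\tau}(\Gamma)})\in E \,\big|\, B_0=z\big).$$ *)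

theory Defs
  imports "HOL-Probability.Probability" "HOL-Complex_Analysis.Complex_Analysis"
begin

definition interpolation :: "nat \<Rightarrow> (nat \<Rightarrow> real) \<Rightarrow> (nat \<Rightarrow> real) \<Rightarrow> real \<Rightarrow> real" where
  "interpolation n t W x =
     (\<Sum>k=1..n. indicator {t (k - 1)<..t k} x *
        ((t k - x) / (t k - t (k - 1)) * W (k - 1) + (x - t (k - 1)) / (t k - t (k - 1)) * W k))"

definition domain_below :: "(real \<Rightarrow> real) \<Rightarrow> complex set" where
  "domain_below g = {z. 0 < Re z \<and> Re z < 1 \<and> Im z < g (Re z)}"

definition graph_curve :: "(real \<Rightarrow> real) \<Rightarrow> complex set" where
  "graph_curve g = {Complex x (g x) | x. 0 \<le> x \<and> x \<le> 1}"

text \<open>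
  Planar Brownian motion under \<open>M\<close>, started at \<open>z\<close>. Only the times \<open>t \<ge> 0\<close> matter, and
  continuity of the paths is required almost surely.
\<close>

definition planar_brownian_motion ::
  "'a measure \<Rightarrow> (real \<Rightarrow> 'a \<Rightarrow> complex) \<Rightarrow> complex \<Rightarrow> bool" where
  "planar_brownian_motion M B z \<longleftrightarrow>
     prob_space M \<and>
     (\<forall>t\<ge>0. B t \<in> borel_measurable M) \<and>
     (AE \<omega> in M. B 0 \<omega> = z) \<and>
     (\<forall>m (s :: nat \<Rightarrow> real). 0 \<le> s 0 \<and> (\<forall>i<m. s i \<le> s (Suc i)) \<longrightarrow>
        prob_space.indep_vars M (\<lambda>_. borel) (\<lambda>i \<omega>. B (s (Suc i)) \<omega> - B (s i) \<omega>) {..<m}) \<and>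
     (\<forall>s t. 0 \<le> s \<and> s < t \<longrightarrow>
        distributed M lborel (\<lambda>\<omega>. Re (B t \<omega> - B s \<omega>)) (normal_density 0 (sqrt (t - s))) \<and>
        distributed M lborel (\<lambda>\<omega>. Im (B t \<omega> - B s \<omega>)) (normal_density 0 (sqrt (t - s))) \<and>
        prob_space.indep_var M borel (\<lambda>\<omega>. Re (B t \<omega> - B s \<omega>))
                               borel (\<lambda>\<omega>. Im (B t \<omega> - B s \<omega>))) \<and>
     (AE \<omega> in M. continuous_on {0..} (\<lambda>t. B t \<omega>))"

definition strip_reflection :: "complex \<Rightarrow> complex" where
  "strip_reflection w = Complex (arccos (cos (pi * Re w)) / pi) (Im w)"

definition hitting_time :: "(real \<Rightarrow> 'a \<Rightarrow> complex) \<Rightarrow> complex set \<Rightarrow> 'a \<Rightarrow> real" where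
  "hitting_time B \<Gamma> \<omega> = (LEAST t. 0 \<le> t \<and> strip_reflection (B t \<omega>) \<in> \<Gamma>)"

text \<open>
  The hitting distribution, as a measure on the Borel subsets of \<open>\<Gamma>\<close>. The probability space is
  completed because the hitting time is unspecified on the null set of outcomes whose path is
  discontinuous or never meets \<open>\<Gamma>\<close>.
\<close>

definition hitting_distribution ::
  "'a measure \<Rightarrow> (real \<Rightarrow> 'a \<Rightarrow> complex) \<Rightarrow> complex set \<Rightarrow> complex measure" where
  "hitting_distribution M B \<Gamma> =
     restrict_space
       (distr (completion M) borel (\<lambda>\<omega>. strip_reflection (B (hitting_time B \<Gamma> \<omega>) \<omega>))) \<Gamma>"

abbreviation upper_half_plane :: "complex set" where
  "upper_half_plane \<equiv> {z. Im z > 0}"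

abbreviation riemann_sphere :: "complex option topology" where
  "riemann_sphere \<equiv> Alexandroff_compactification euclidean"

text \<open>
  \<open>\<phi>\<close> stands for the conformal map together with its extension to the real line; its values off
  the closed upper half-plane are irrelevant. The point at infinity is \<^term>\<open>None\<close>, so that
  \<^term>\<open>map_option \<phi>\<close> is the extension of \<open>\<phi>\<close> that sends infinity to infinity.
\<close>

definition normalized_conformal_map ::
  "complex set \<Rightarrow> complex set \<Rightarrow> (complex \<Rightarrow> complex) \<Rightarrow> bool" where
  "normalized_conformal_map U \<Gamma> \<phi> \<longleftrightarrow>
     \<phi> holomorphic_on upper_half_plane \<and>
     bij_betw \<phi> upper_half_plane U \<and>
     homeomorphic_map
       (subtopology riemann_sphere
          (Some ` upper_half_plane \<union> Some ` range complex_of_real \<union> {None}))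
       (subtopology riemann_sphere (riemann_sphere closure_of (Some ` U)))
       (map_option \<phi>) \<and>
     bij_betw \<phi> (complex_of_real ` {0..1}) \<Gamma>"

definition harmonic_measure_infinity ::
  "complex set \<Rightarrow> (complex \<Rightarrow> complex) \<Rightarrow> complex measure" where
  "harmonic_measure_infinity \<Gamma> \<phi> =
     measure_of \<Gamma> (sets (restrict_space borel \<Gamma>))
       (\<lambda>E. ennreal (1 / pi) *
          (\<integral>\<^sup>+x\<in>{0..1}. ennreal (indicator E (\<phi> (complex_of_real x)) / sqrt (x * (1 - x))) \<partial>lborel))"

text \<open>
  As usual, \<^const>\<open>measure_of\<close> gives the null measure if the set function is not countably
  additive. The next fact shows that this does not happen, so that the formula for
  \<^const>\<open>harmonic_measure_infinity\<close> holds on all Borel subsets of \<open>\<Gamma>\<close>.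
\<close>

lemma emeasure_harmonic_measure_infinity:
  assumes cont: "continuous_on {0..1} (\<lambda>x. \<phi> (complex_of_real x))"
    and E: "E \<in> sets borel" "E \<subseteq> \<Gamma>" and \<Gamma>: "\<Gamma> \<in> sets borel"
  shows "emeasure (harmonic_measure_infinity \<Gamma> \<phi>) E = ennreal (1 / pi) *
          (\<integral>\<^sup>+x\<in>{0..1}. ennreal (indicator E (\<phi> (complex_of_real x)) / sqrt (x * (1 - x))) \<partial>lborel)"
proof -
  let ?\<mu> = "\<lambda>E. ennreal (1 / pi) *
    (\<integral>\<^sup>+x\<in>{0..1}. ennreal (indicator E (\<phi> (complex_of_real x)) / sqrt (x * (1 - x))) \<partial>lborel)"
  define g where "g x = (if x \<in> {0..1} then \<phi> (complex_of_real x) else 0)" for x :: real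
  have [measurable]: "g \<in> borel_measurable borel"
    unfolding g_def using cont
    by (intro borel_measurable_continuous_on_if) auto
  define N where "N = distr (density lborel
      (\<lambda>x. ennreal (1 / pi) * (ennreal (1 / sqrt (x * (1 - x))) * indicator {0..1} x))) borel g"
  have N: "emeasure N A = ?\<mu> A" if [measurable]: "A \<in> sets borel" for A
  proof -
    have [measurable]: "g -` A \<in> sets borel"
      using measurable_sets_borel[of g borel A] by simp
    have "emeasure N A = (\<integral>\<^sup>+x. ennreal (1 / pi) *
        (ennreal (1 / sqrt (x * (1 - x))) * indicator {0..1} x * indicator (g -` A) x) \<partial>lborel)"
      unfolding N_def
      by (subst emeasure_distr, simp, simp, subst emeasure_density)
         (auto simp: mult.assoc)
    also have "\<dots> = ennreal (1 / pi) * (\<integral>\<^sup>+x.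
        (ennreal (1 / sqrt (x * (1 - x))) * indicator {0..1} x * indicator (g -` A) x) \<partial>lborel)"
      by (rule nn_integral_cmult) measurable
    also have "\<dots> = ?\<mu> A"
      by (rule arg_cong[where f = "\<lambda>y. ennreal (1 / pi) * y"], rule nn_integral_cong)
         (auto simp: g_def split: split_indicator)
    finally show ?thesis .
  qed
  have sets: "sets (restrict_space borel \<Gamma>) = {A \<in> sets borel. A \<subseteq> \<Gamma>}"
    using \<Gamma> by (auto simp: sets_restrict_space image_iff)
  have sa: "sigma_algebra \<Gamma> (sets (restrict_space borel \<Gamma>))"
    using sets.sigma_algebra_axioms[of "restrict_space borel \<Gamma>"] by (simp add: space_restrict_space)
  interpret sigma_algebra \<Gamma> "sets (restrict_space borel \<Gamma>)" by (fact sa)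
  show ?thesis
  proof (rule emeasure_measure_of[OF harmonic_measure_infinity_def])
    show "sets (restrict_space borel \<Gamma>) \<subseteq> Pow \<Gamma>" using sets by auto
    show "positive (sets (harmonic_measure_infinity \<Gamma> \<phi>)) ?\<mu>"
      by (simp add: positive_def)
    have eq: "sets (harmonic_measure_infinity \<Gamma> \<phi>) = {A \<in> sets borel. A \<subseteq> \<Gamma>}"
      unfolding harmonic_measure_infinity_def using sets sigma_sets_eq
      by (subst sets_measure_of) auto
    show "E \<in> sets (harmonic_measure_infinity \<Gamma> \<phi>)" using eq E by simp
    show "countably_additive (sets (harmonic_measure_infinity \<Gamma> \<phi>)) ?\<mu>"
      unfolding countably_additive_def eq
    proof (intro allI impI)
      fix A :: "nat \<Rightarrow> complex set"
      assume A: "range A \<subseteq> {A \<in> sets borel. A \<subseteq> \<Gamma>}" "disjoint_family A"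
        "\<Union> (range A) \<in> {A \<in> sets borel. A \<subseteq> \<Gamma>}"
      have "(\<Sum>i. emeasure N (A i)) = emeasure N (\<Union> (range A))"
        using A by (intro suminf_emeasure) (auto simp: N_def)
      moreover have "\<And>i. A i \<in> sets borel" "\<Union> (range A) \<in> sets borel" using A by auto
      ultimately show "(\<Sum>i. ?\<mu> (A i)) = ?\<mu> (\<Union> (range A))"
        using N by simp
    qed
  qed
qed

text \<open>
  Weak convergence along a filter, for measures on the Borel subsets of one and the same
  topological subspace \<^term>\<open>space \<mu>\<close>.
\<close>

definition weakly_converges ::
  "('b \<Rightarrow> 'a::topological_space measure) \<Rightarrow> 'a measure \<Rightarrow> 'b filter \<Rightarrow> bool" where
  "weakly_converges \<nu> \<mu> F \<longleftrightarrow>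
     (\<forall>f :: 'a \<Rightarrow> real. continuous_on (space \<mu>) f \<and> bounded (f ` space \<mu>) \<longrightarrow>
        ((\<lambda>i. \<integral>x. f x \<partial>\<nu> i) \<longlongrightarrow> (\<integral>x. f x \<partial>\<mu>)) F)"

end

theory Submission
  imports Defs
begin

text \<open>
  Unfold the strip by reflection: the reflected motion meets \<open>\<Gamma>\<close> when the planar motion leaves the
  region \<open>V\<close> below the even, 2-periodic extension of the curve. Let \<open>s\<close> be the inverse Joukowski map
  of the upper half-plane onto the upper half-disc that sends \<open>[0,1]\<close> to the half-circle, with
  \<open>s ((1 - cos \<theta>) / 2) = cis \<theta>\<close>, the rest of the real line to the diameter, and infinity to \<open>0\<close>.
  For a polynomial \<open>q\<close> with real coefficients, \<open>h = q \<circ> s \<circ> inverse \<phi>\<close> is bounded, holomorphic in \<open>U\<close>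
  and real on the vertical sides, so by Schwarz reflection it extends to \<open>V\<close>, and \<open>Re h\<close> is
  harmonic with zero normal derivative on the sides. Hence the expectation of \<open>Re h\<close> at the hitting
  point is \<open>Re (h z)\<close>, which tends to \<open>q 0\<close> as \<open>z\<close> tends to infinity. On the other hand \<open>q 0\<close> is
  the mean of \<open>Re (q (cis \<theta>))\<close> over \<open>[0, pi]\<close>, that is, the integral of \<open>Re h\<close> against the image
  of the arcsine law. By the Weierstrass theorem the functions \<open>Re h\<close> are uniformly dense in the
  continuous functions on \<open>\<Gamma>\<close>.
\<close>

section \<open>Exit points of planar Brownian motion\<close>

text \<open>The sides of the strip carry a Neumann condition and the curve a Dirichlet condition. In
  the half-disc these become the diameter and the half-circle; conjugation completes it to the unit
  disc with infinity at the centre, from which harmonic measure is uniform. The substitution x = (1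
  - cos \<theta>) / 2 turns this into the arcsine law. Real coefficients serve twice: they make h
  real on the sides, and they make the mean over the half-circle equal to the mean over the full
  circle. The obstacle is the expectation at the exit point: Re h is harmonic only inside V and
  merely continuous up to the boundary, and the exit time has no a priori bound. Taylor expansions
  are therefore made only at a definite distance from the boundary and up to a fixed time; path
  continuity and dominated convergence remove both cut-offs, once Re h has been extended to a
  bounded continuous function on the whole plane.\<close>

lemma Re_holomorphic_Taylor_bound:
  fixes g :: "complex \<Rightarrow> complex" and H :: "complex \<Rightarrow> real"
  assumes "0 < \<delta>" and hol: "g holomorphic_on ball z \<delta>"
    and gC: "\<And>w. w \<in> ball z \<delta> \<Longrightarrow> cmod (g w) \<le> C"
    and HC: "\<And>w. \<bar>H w\<bar> \<le> C" and Hg: "\<And>w. w \<in> ball z \<delta> \<Longrightarrow> H w = Re (g w)"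
  shows "cmod (deriv g z) \<le> 2 * C / \<delta>"
    and "cmod ((deriv ^^ 2) g z) \<le> 8 * C / \<delta>\<^sup>2"
    and "\<bar>H (z + x) - H z - Re (deriv g z * x + (deriv ^^ 2) g z / 2 * x\<^sup>2)\<bar>
      \<le> 192 * C / \<delta> ^ 3 * cmod x ^ 3"
proof -
  have "0 \<le> C" using HC[of 0] by linarith
  have bd: "cmod ((deriv ^^ k) g y) \<le> fact k * C / r ^ k"
    if "cball y r \<subseteq> ball z \<delta>" "0 < r" for y r k
  proof (rule Cauchy_inequality)
    show "g holomorphic_on ball y r"
      using hol by (rule holomorphic_on_subset) (use that ball_subset_cball in blast)
    show "continuous_on (cball y r) g"
      by (rule continuous_on_subset[OF holomorphic_on_imp_continuous_on[OF hol]]) (use that in auto)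
    show "cmod (g u) \<le> C" if "cmod (y - u) = r" for u
      using that \<open>cball y r \<subseteq> _\<close> by (intro gC) (auto simp: dist_norm)
  qed (use that in auto)
  have sub: "cball z (\<delta>/2) \<subseteq> ball z \<delta>" using \<open>0 < \<delta>\<close> by auto
  show 1: "cmod (deriv g z) \<le> 2 * C / \<delta>"
    using bd[OF sub, of 1] \<open>0 < \<delta>\<close> by (simp add: field_simps)
  show 2: "cmod ((deriv ^^ 2) g z) \<le> 8 * C / \<delta>\<^sup>2"
    using bd[OF sub, of 2] \<open>0 < \<delta>\<close> by (simp add: field_simps fact_numeral)
  show "\<bar>H (z + x) - H z - Re (deriv g z * x + (deriv ^^ 2) g z / 2 * x\<^sup>2)\<bar>
      \<le> 192 * C / \<delta> ^ 3 * cmod x ^ 3"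
  proof (cases "cmod x < \<delta> / 2")
    case True
    \<comment> \<open>Here 384 = 3! * 4^3, from Cauchy's inequality for the third derivative on
      balls of radius \<delta>/4 centred in \<open>ball z (\<delta>/2)\<close>. The division by 2!
      in the Taylor remainder then gives the final 192.\<close>
    have "cmod ((deriv ^^ 0) g (z + x) - (\<Sum>i\<le>2. (deriv ^^ i) g z * (z + x - z) ^ i / fact i))
      \<le> (384 * C / \<delta> ^ 3) * cmod (z + x - z) ^ Suc 2 / fact 2"
    proof (rule complex_Taylor[where S = "ball z (\<delta>/2)"])
      fix i y assume "y \<in> ball z (\<delta>/2)"
      then have "y \<in> ball z \<delta>" using \<open>0 < \<delta>\<close> by auto
      then have "((deriv ^^ i) g has_field_derivative deriv ((deriv ^^ i) g) y) (at y)"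
        by (intro holomorphic_derivI[OF holomorphic_higher_deriv[OF hol]]) auto
      then show "((deriv ^^ i) g has_field_derivative (deriv ^^ Suc i) g y) (at y within ball z (\<delta>/2))"
        by (simp add: has_field_derivative_at_within)
    next
      fix y assume y: "y \<in> ball z (\<delta>/2)"
      have "cball y (\<delta>/4) \<subseteq> ball z \<delta>"
      proof
        fix u assume "u \<in> cball y (\<delta>/4)"
        then show "u \<in> ball z \<delta>" using y dist_triangle[of z u y] \<open>0 < \<delta>\<close> by auto
      qed
      from bd[OF this, of 3] show "cmod ((deriv ^^ Suc 2) g y) \<le> 384 * C / \<delta> ^ 3"
        using \<open>0 < \<delta>\<close> by (simp add: field_simps fact_numeral numeral_3_eq_3)
    qed (use \<open>0 < \<delta>\<close> True in \<open>auto simp: dist_norm\<close>)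
    moreover have "H (z + x) - H z - Re (deriv g z * x + (deriv ^^ 2) g z / 2 * x\<^sup>2) =
       Re (g (z + x) - (\<Sum>i\<le>2. (deriv ^^ i) g z * x ^ i / fact i))"
      using True \<open>0 < \<delta>\<close> by (simp add: Hg dist_norm numeral_2_eq_2 atMost_Suc)
    ultimately show ?thesis
      using abs_Re_le_cmod[of "g (z + x) - (\<Sum>i\<le>2. (deriv ^^ i) g z * x ^ i / fact i)"]
      by (simp add: numeral_3_eq_3)
  next
    case False
    \<comment> \<open>A Gaussian increment may leave the ball, so the cubic bound is wanted for
      every \<open>x\<close>. Far out, the crude bounds on \<open>H\<close> and on the two
      derivatives suffice, because 1, t and t^2 are all bounded by multiples of t^3 when t \<ge>
      1/2.\<close>
    define t where "t = cmod x / \<delta>"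
    have t: "t \<ge> 1/2" using False \<open>0 < \<delta>\<close> by (simp add: t_def field_simps)
    have xt: "cmod x = t * \<delta>" using \<open>0 < \<delta>\<close> by (simp add: t_def)
    have t1: "t\<^sup>2 \<ge> 1/4" using power_mono[OF t, of 2] by (simp add: power2_eq_square)
    then have t3: "t ^ 3 \<ge> t / 4" using t mult_left_mono[OF t1, of t] by (simp add: power3_eq_cube power2_eq_square)
    have t2: "t ^ 3 \<ge> t\<^sup>2 / 2" using t mult_right_mono[OF t, of "t\<^sup>2"] by (simp add: power3_eq_cube power2_eq_square)
    have "cmod (deriv g z * x) \<le> 2 * C / \<delta> * (t * \<delta>)"
      unfolding norm_mult xt by (intro mult_right_mono 1) (use t \<open>0 < \<delta>\<close> in auto)
    then have a: "cmod (deriv g z * x) \<le> 2 * C * t" using \<open>0 < \<delta>\<close> by simp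
    have "cmod ((deriv ^^ 2) g z / 2 * x\<^sup>2) \<le> (8 * C / \<delta>\<^sup>2) / 2 * (t * \<delta>)\<^sup>2"
    proof -
      have "cmod ((deriv ^^ 2) g z) / 2 * (t * \<delta>)\<^sup>2 \<le> (8 * C / \<delta>\<^sup>2) / 2 * (t * \<delta>)\<^sup>2"
        using 2 by (intro mult_right_mono divide_right_mono) auto
      then show ?thesis unfolding norm_mult norm_power xt norm_divide norm_numeral .
    qed
    then have b: "cmod ((deriv ^^ 2) g z / 2 * x\<^sup>2) \<le> 4 * C * t\<^sup>2"
      using \<open>0 < \<delta>\<close> by (simp add: power_mult_distrib)
    have "\<bar>Re (deriv g z * x + (deriv ^^ 2) g z / 2 * x\<^sup>2)\<bar> \<le> 2 * C * t + 4 * C * t\<^sup>2"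
      using a b abs_Re_le_cmod[of "deriv g z * x + (deriv ^^ 2) g z / 2 * x\<^sup>2"]
        norm_triangle_ineq[of "deriv g z * x" "(deriv ^^ 2) g z / 2 * x\<^sup>2"] by linarith
    then have "\<bar>H (z + x) - H z - Re (deriv g z * x + (deriv ^^ 2) g z / 2 * x\<^sup>2)\<bar>
      \<le> C * (2 + 2 * t + 4 * t\<^sup>2)"
      using HC[of "z + x"] HC[of z] by (simp add: algebra_simps)
    also have "\<dots> \<le> C * (192 * t ^ 3)"
      using t t1 t2 t3 by (intro mult_left_mono \<open>0 \<le> C\<close>) linarith
    also have "\<dots> = 192 * C / \<delta> ^ 3 * cmod x ^ 3"
      using \<open>0 < \<delta>\<close> by (simp add: xt power_mult_distrib)
    finally show ?thesis .
  qed
qed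

text \<open>\<open>Y\<close> is the past and \<open>\<Delta>\<close> the next increment. By
  independence the linear and quadratic Taylor terms have mean zero, as both \<open>\<Delta>\<close>
  and its complex square do, and only the cubic remainder is left. Harmonicity enters here: the
  second-order term of the real part of a holomorphic function involves the complex square of the
  increment and not its squared modulus.\<close>

lemma (in prob_space) indep_Taylor_step:
  fixes p :: "'b \<Rightarrow> complex" and Y Z :: "'a \<Rightarrow> 'b" and d :: "'b \<Rightarrow> complex" and H :: "complex \<Rightarrow> real"
  defines "\<Delta> \<equiv> \<lambda>\<omega>. d (Z \<omega>)"
  assumes ind: "indep_var N Y N' Z" and d[measurable]: "d \<in> borel_measurable N'" and A[measurable]: "A \<in> sets N"
    and p[measurable]: "p \<in> borel_measurable N"
    and abm[measurable]: "a \<in> borel_measurable borel" "b \<in> borel_measurable borel"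
      "H \<in> borel_measurable borel"
    and ab: "\<And>w. cmod (a w) \<le> K'" "\<And>w. cmod (b w) \<le> K'"
    and Tay: "\<And>y x. y \<in> A \<Longrightarrow> \<bar>H (p y + x) - H (p y) - Re (a (p y) * x + b (p y) * x\<^sup>2)\<bar> \<le> K * cmod x ^ 3"
    and int: "integrable M \<Delta>" "integrable M (\<lambda>\<omega>. (\<Delta> \<omega>)\<^sup>2)" "integrable M (\<lambda>\<omega>. cmod (\<Delta> \<omega>) ^ 3)"
    and zero: "(\<integral>\<omega>. \<Delta> \<omega> \<partial>M) = 0" "(\<integral>\<omega>. (\<Delta> \<omega>)\<^sup>2 \<partial>M) = 0"
    and "0 \<le> K" and HC: "\<And>w. \<bar>H w\<bar> \<le> C"
  shows "\<bar>\<integral>\<omega>. indicator A (Y \<omega>) * (H (p (Y \<omega>) + \<Delta> \<omega>) - H (p (Y \<omega>))) \<partial>M\<bar>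
    \<le> K * (\<integral>\<omega>. cmod (\<Delta> \<omega>) ^ 3 \<partial>M)"
proof -
  have [measurable]: "Y \<in> measurable M N" "Z \<in> measurable M N'"
    using ind unfolding indep_var_eq by auto
  have [measurable]: "\<Delta> \<in> borel_measurable M" unfolding \<Delta>_def by measurable
  \<comment> \<open>With the indicator inside, \<open>u\<close> is a single bounded function of
    \<open>Y\<close>, so independence factorizes its product with a power of
    \<open>\<Delta>\<close>.\<close>
  define u where "u c y = complex_of_real (indicator A y) * c (p y)" for c :: "complex \<Rightarrow> complex" and y
  have um: "u c \<in> borel_measurable N" if [measurable]: "c \<in> borel_measurable borel" for c
    unfolding u_def by measurable
  have i: "integrable M (\<lambda>\<omega>. u c (Y \<omega>))" if [measurable]: "c \<in> borel_measurable borel" and "\<And>w. cmod (c w) \<le> K'" for c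
    using that um[OF that(1)] unfolding u_def 
    by (intro integrable_const_bound[where B=K'])
       (auto simp: norm_mult split: split_indicator intro: order_trans[OF norm_ge_zero that(2)])
  have I: "integrable M (\<lambda>\<omega>. u c (Y \<omega>) * q (\<Delta> \<omega>)) \<and> (\<integral>\<omega>. u c (Y \<omega>) * q (\<Delta> \<omega>) \<partial>M) = 0"
    if [measurable]: "c \<in> borel_measurable borel" "q \<in> borel_measurable borel"
      and cK: "\<And>w. cmod (c w) \<le> K'" and iq: "integrable M (\<lambda>\<omega>. q (\<Delta> \<omega>))" "(\<integral>\<omega>. q (\<Delta> \<omega>) \<partial>M) = 0"
    for c q :: "complex \<Rightarrow> complex"
  proof -
    have "indep_var borel (u c \<circ> Y) borel ((\<lambda>z. q (d z)) \<circ> Z)"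
      by (intro indep_var_compose[OF ind] um) auto
    then have "indep_var borel (\<lambda>\<omega>. u c (Y \<omega>)) borel (\<lambda>\<omega>. q (\<Delta> \<omega>))" by (simp add: comp_def \<Delta>_def)
    from indep_var_lebesgue_integral[OF this i iq(1)] indep_var_integrable[OF this i iq(1)] iq cK
    show ?thesis by auto
  qed
  have Ia: "integrable M (\<lambda>\<omega>. u a (Y \<omega>) * \<Delta> \<omega>)" "(\<integral>\<omega>. u a (Y \<omega>) * \<Delta> \<omega> \<partial>M) = 0"
    using I[of a "\<lambda>x. x", OF abm(1) _ ab(1) int(1) zero(1)] by simp_all
  have Ib: "integrable M (\<lambda>\<omega>. u b (Y \<omega>) * (\<Delta> \<omega>)\<^sup>2)" "(\<integral>\<omega>. u b (Y \<omega>) * (\<Delta> \<omega>)\<^sup>2 \<partial>M) = 0"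
    using I[of b "\<lambda>x. x\<^sup>2", OF abm(2) _ ab(2) int(2) zero(2)] by simp_all
  define L where "L \<omega> = Re (u a (Y \<omega>) * \<Delta> \<omega> + u b (Y \<omega>) * (\<Delta> \<omega>)\<^sup>2)" for \<omega>
  define D where "D \<omega> = indicator A (Y \<omega>) * (H (p (Y \<omega>) + \<Delta> \<omega>) - H (p (Y \<omega>)))" for \<omega>
  have L: "integrable M L" "(\<integral>\<omega>. L \<omega> \<partial>M) = 0"
  proof -
    let ?c = "\<lambda>\<omega>. u a (Y \<omega>) * \<Delta> \<omega> + u b (Y \<omega>) * (\<Delta> \<omega>)\<^sup>2"
    have "integrable M ?c" by (intro Bochner_Integration.integrable_add Ia Ib)
    moreover have "(\<integral>\<omega>. ?c \<omega> \<partial>M) = 0"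
      unfolding Bochner_Integration.integral_add[OF Ia(1) Ib(1)] Ia Ib by simp
    ultimately show "integrable M L" "(\<integral>\<omega>. L \<omega> \<partial>M) = 0"
      unfolding L_def using integral_Re[of M ?c] integrable_Re[of M ?c] by auto
  qed
  have Dm[measurable]: "D \<in> borel_measurable M" unfolding D_def by measurable
  have iD: "integrable M D"
  proof (rule integrable_const_bound[where B="2 * C"])
    show "AE \<omega> in M. norm (D \<omega>) \<le> 2 * C"
    proof (intro AE_I2)
      fix \<omega>
      show "norm (D \<omega>) \<le> 2 * C"
        using HC[of "p (Y \<omega>) + \<Delta> \<omega>"] HC[of "p (Y \<omega>)"] unfolding D_def by (auto split: split_indicator)
    qed
  qed simp
  have "\<bar>\<integral>\<omega>. D \<omega> \<partial>M\<bar> = \<bar>\<integral>\<omega>. D \<omega> - L \<omega> \<partial>M\<bar>" using L iD by simp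
  also have "\<dots> \<le> (\<integral>\<omega>. \<bar>D \<omega> - L \<omega>\<bar> \<partial>M)" by (rule integral_abs_bound)
  also have "\<dots> \<le> (\<integral>\<omega>. K * cmod (\<Delta> \<omega>) ^ 3 \<partial>M)"
  proof (rule integral_mono)
    fix \<omega>
    show "\<bar>D \<omega> - L \<omega>\<bar> \<le> K * cmod (\<Delta> \<omega>) ^ 3"
    proof (cases "Y \<omega> \<in> A")
      case True
      have "D \<omega> - L \<omega> = H (p (Y \<omega>) + \<Delta> \<omega>) - H (p (Y \<omega>)) -
          Re (a (p (Y \<omega>)) * \<Delta> \<omega> + b (p (Y \<omega>)) * (\<Delta> \<omega>)\<^sup>2)"
        using True by (simp add: D_def L_def u_def)
      with Tay[OF True, of "\<Delta> \<omega>"] show ?thesis by simp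
    qed (use \<open>0 \<le> K\<close> in \<open>auto simp: D_def L_def u_def\<close>)
  qed (use iD L int in auto)
  finally show ?thesis by (simp add: D_def)
qed

section \<open>Moments of Brownian increments\<close>

lemma (in prob_space) centered_normal_moments:
  fixes X :: "'a \<Rightarrow> real"
  assumes X: "distributed M lborel X (normal_density 0 \<sigma>)" and "0 < \<sigma>"
  shows "integrable M X" "expectation X = 0" "integrable M (\<lambda>x. X x ^ 2)" "expectation (\<lambda>x. X x ^ 2) = \<sigma>\<^sup>2"
    "integrable M (\<lambda>x. \<bar>X x\<bar> ^ 3)" "expectation (\<lambda>x. \<bar>X x\<bar> ^ 3) \<le> 2 * \<sigma> ^ 3"
proof -
  note d = distributed_integral[OF X] distributed_integrable[OF X]
  show "integrable M X"
    using integrable_normal_moment[OF \<open>0 < \<sigma>\<close>, of 0 1] d(2)[of "\<lambda>x. x"] by simp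
  show "expectation X = 0"
    using integral_normal_moment_odd[OF \<open>0 < \<sigma>\<close>, of 0 0] d(1)[of "\<lambda>x. x"] by simp
  show "integrable M (\<lambda>x. X x ^ 2)"
    using integrable_normal_moment[OF \<open>0 < \<sigma>\<close>, of 0 2] d(2)[of "\<lambda>x. x^2"] by simp
  show "expectation (\<lambda>x. X x ^ 2) = \<sigma>\<^sup>2"
    using integral_normal_moment_even[OF \<open>0 < \<sigma>\<close>, of 0 1] d(1)[of "\<lambda>x. x^2"] by simp
  show "integrable M (\<lambda>x. \<bar>X x\<bar> ^ 3)"
    using integrable_normal_moment_abs[OF \<open>0 < \<sigma>\<close>, of 0 3] d(2)[of "\<lambda>x. \<bar>x\<bar>^3"] by simp
  have "expectation (\<lambda>x. \<bar>X x\<bar> ^ 3) = 2 * \<sigma> ^ 3 * sqrt (2 / pi)"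
    using integral_normal_moment_abs_odd[OF \<open>0 < \<sigma>\<close>, of 0 1] d(1)[of "\<lambda>x. \<bar>x\<bar>^3"] by simp
  also have "\<dots> \<le> 2 * \<sigma> ^ 3"
    using pi_ge_two \<open>0 < \<sigma>\<close> by (simp add: field_simps)
  finally show "expectation (\<lambda>x. \<bar>X x\<bar> ^ 3) \<le> 2 * \<sigma> ^ 3" .
qed

text \<open>The complex square has mean zero because the two coordinates have equal variances and
  are uncorrelated. The constant 16 is 4 * (2 + 2): a factor 4 from (a + b)^3 \<le> 4 (a^3 + b^3),
  and a factor 2 from the third absolute moment of each coordinate.\<close>

lemma planar_brownian_motion_increment_moments:
  assumes bm: "planar_brownian_motion M B z" and "0 \<le> s" "s < t"
  defines "\<Delta> \<equiv> \<lambda>\<omega>. B t \<omega> - B s \<omega>"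
  shows "integrable M \<Delta>" "(\<integral>\<omega>. \<Delta> \<omega> \<partial>M) = 0"
    "integrable M (\<lambda>\<omega>. (\<Delta> \<omega>)\<^sup>2)" "(\<integral>\<omega>. (\<Delta> \<omega>)\<^sup>2 \<partial>M) = 0"
    "integrable M (\<lambda>\<omega>. cmod (\<Delta> \<omega>) ^ 3)" "(\<integral>\<omega>. cmod (\<Delta> \<omega>) ^ 3 \<partial>M) \<le> 16 * sqrt (t - s) ^ 3"
proof -
  interpret prob_space M using bm unfolding planar_brownian_motion_def by blast
  define X Y where "X \<omega> = Re (\<Delta> \<omega>)" and "Y \<omega> = Im (\<Delta> \<omega>)" for \<omega>
  have [measurable]: "\<Delta> \<in> borel_measurable M"
    using bm \<open>0 \<le> s\<close> \<open>s < t\<close> unfolding planar_brownian_motion_def \<Delta>_def by (intro borel_measurable_diff) auto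
  have \<Delta>: "\<Delta> = (\<lambda>\<omega>. complex_of_real (X \<omega>) + \<i> * complex_of_real (Y \<omega>))"
    by (auto simp: X_def Y_def complex_eq_iff)
  have dX: "distributed M lborel X (normal_density 0 (sqrt (t - s)))"
    and dY: "distributed M lborel Y (normal_density 0 (sqrt (t - s)))"
    and ind: "indep_var borel X borel Y"
    using bm \<open>0 \<le> s\<close> \<open>s < t\<close> unfolding planar_brownian_motion_def \<Delta>_def X_def Y_def by auto
  have s0: "0 < sqrt (t - s)" using \<open>s < t\<close> by simp
  note mX = centered_normal_moments[OF dX s0]
  note mY = centered_normal_moments[OF dY s0]
  show "integrable M \<Delta>" "(\<integral>\<omega>. \<Delta> \<omega> \<partial>M) = 0"
    unfolding \<Delta> using mX mY by (auto simp: integral_complex_of_real)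
  have XY: "integrable M (\<lambda>\<omega>. X \<omega> * Y \<omega>)" "(\<integral>\<omega>. X \<omega> * Y \<omega> \<partial>M) = 0"
    using indep_var_lebesgue_integral[OF ind] indep_var_integrable[OF ind] mX mY by auto
  have sq: "(\<lambda>\<omega>. (\<Delta> \<omega>)\<^sup>2) = (\<lambda>\<omega>. complex_of_real ((X \<omega>)\<^sup>2 - (Y \<omega>)\<^sup>2) + \<i> * complex_of_real (2 * (X \<omega> * Y \<omega>)))"
    unfolding \<Delta> by (auto simp: complex_eq_iff power2_eq_square)
  have i2: "integrable M (\<lambda>\<omega>. complex_of_real ((X \<omega>)\<^sup>2 - (Y \<omega>)\<^sup>2))"
     "integrable M (\<lambda>\<omega>. \<i> * complex_of_real (2 * (X \<omega> * Y \<omega>)))"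
    using mX mY XY by (auto simp del: of_real_diff of_real_mult)
  show "integrable M (\<lambda>\<omega>. (\<Delta> \<omega>)\<^sup>2)"
    unfolding sq by (intro Bochner_Integration.integrable_add i2)
  show "(\<integral>\<omega>. (\<Delta> \<omega>)\<^sup>2 \<partial>M) = 0"
    unfolding sq Bochner_Integration.integral_add[OF i2]
    using mX mY XY by (simp add: integral_complex_of_real del: of_real_diff of_real_mult)
  have le: "cmod (\<Delta> \<omega>) ^ 3 \<le> 4 * (\<bar>X \<omega>\<bar> ^ 3 + \<bar>Y \<omega>\<bar> ^ 3)" for \<omega>
  proof -
    have conv: "(a + b) ^ 3 \<le> 4 * (a ^ 3 + b ^ 3)" if "0 \<le> a" "0 \<le> b" for a b :: real
    proof -
      have "4 * (a ^ 3 + b ^ 3) - (a + b) ^ 3 = 3 * (a + b) * (a - b)\<^sup>2"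
        by (simp add: power2_eq_square power3_eq_cube algebra_simps)
      also have "\<dots> \<ge> 0" using that by simp
      finally show ?thesis by simp
    qed
    have "cmod (\<Delta> \<omega>) ^ 3 \<le> (\<bar>X \<omega>\<bar> + \<bar>Y \<omega>\<bar>) ^ 3"
      unfolding X_def Y_def by (intro power_mono cmod_le) auto
    also have "\<dots> \<le> 4 * (\<bar>X \<omega>\<bar> ^ 3 + \<bar>Y \<omega>\<bar> ^ 3)" by (rule conv) auto
    finally show ?thesis .
  qed
  show i3: "integrable M (\<lambda>\<omega>. cmod (\<Delta> \<omega>) ^ 3)"
    by (rule Bochner_Integration.integrable_bound[of M "\<lambda>\<omega>. 4 * (\<bar>X \<omega>\<bar> ^ 3 + \<bar>Y \<omega>\<bar> ^ 3)"])
       (use mX mY le in \<open>auto simp del: distrib_left_numeral\<close>)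
  have "(\<integral>\<omega>. cmod (\<Delta> \<omega>) ^ 3 \<partial>M) \<le> (\<integral>\<omega>. 4 * (\<bar>X \<omega>\<bar> ^ 3 + \<bar>Y \<omega>\<bar> ^ 3) \<partial>M)"
    by (rule integral_mono[OF i3]) (use mX mY le in auto)
  also have "\<dots> = 4 * ((\<integral>\<omega>. \<bar>X \<omega>\<bar> ^ 3 \<partial>M) + (\<integral>\<omega>. \<bar>Y \<omega>\<bar> ^ 3 \<partial>M))"
    using mX mY by simp
  also have "\<dots> \<le> 16 * sqrt (t - s) ^ 3" using mX(6) mY(6) by simp
  finally show "(\<integral>\<omega>. cmod (\<Delta> \<omega>) ^ 3 \<partial>M) \<le> 16 * sqrt (t - s) ^ 3" .
qed

text \<open>This is min (N, first l with \<open>s l\<close> outside \<open>D\<close>). With the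
  recursion in \<open>N\<close>, passing from \<open>N\<close> to \<open>Suc N\<close> visibly
  changes the value only if the positions 0, ..., N all lie in \<open>D\<close>, which is the event
  of the one-step estimate below. The truncation also gives a value when no exit occurs.\<close>

primrec exit_index :: "'b set \<Rightarrow> (nat \<Rightarrow> 'b) \<Rightarrow> nat \<Rightarrow> nat" where
  "exit_index D s 0 = 0"
| "exit_index D s (Suc N) = (if \<forall>l\<le>N. s l \<in> D then Suc N else exit_index D s N)"

lemma exit_index_le: "exit_index D s N \<le> N"
  by (induction N) auto

lemma exit_index_stays: "l < exit_index D s N \<Longrightarrow> s l \<in> D"
  by (induction N) (auto split: if_splits)

lemma exit_index_eq: "(\<And>l. l < N \<Longrightarrow> s l \<in> D) \<Longrightarrow> exit_index D s N = N"
  by (cases N) auto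

lemma exit_index_exits: "exit_index D s N < N \<Longrightarrow> s (exit_index D s N) \<notin> D"
proof (induction N)
  case (Suc N)
  show ?case
  proof (cases "\<forall>l\<le>N. s l \<in> D")
    case False
    show ?thesis
    proof (cases "exit_index D s N < N")
      case neq: False
      then have "exit_index D s N = N" using exit_index_le[of D s N] by simp
      then show ?thesis using False exit_index_stays[of _ D s N] by (auto simp: le_less)
    qed (use Suc False in auto)
  qed (use Suc in auto)
qed simp

lemma exit_index_leI: "s l \<notin> D \<Longrightarrow> exit_index D s N \<le> l"
  using exit_index_stays[of l D s N] by (meson not_le)

lemma exit_value_measurable:
  fixes X :: "nat \<Rightarrow> 'a \<Rightarrow> complex"
  assumes [measurable]: "\<And>k. X k \<in> borel_measurable M" "D \<in> sets borel"
  shows "(\<lambda>\<omega>. X (exit_index D (\<lambda>k. X k \<omega>) N) \<omega>) \<in> borel_measurable M"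
proof (induction N)
  case (Suc N)
  have "(\<lambda>\<omega>. X (exit_index D (\<lambda>k. X k \<omega>) (Suc N)) \<omega>) =
    (\<lambda>\<omega>. if \<forall>l\<le>N. X l \<omega> \<in> D then X (Suc N) \<omega> else X (exit_index D (\<lambda>k. X k \<omega>) N) \<omega>)"
    by (intro ext) auto
  also have "\<dots> \<in> borel_measurable M" using Suc by measurable
  finally show ?case .
qed simp

text \<open>The values stopped at \<open>N\<close> and at \<open>Suc N\<close> differ only when the
  process has stayed in \<open>D\<close> up to step \<open>N\<close>. That event, and the position
  at step \<open>N\<close>, are functions of the first \<open>N\<close> increments, hence
  independent of the next one, so \<open>indep_Taylor_step\<close> applies.\<close>

lemma planar_brownian_motion_exit_step:
  fixes g :: "complex \<Rightarrow> complex" and H :: "complex \<Rightarrow> real"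
  assumes bm: "planar_brownian_motion M B z" and "0 < \<epsilon>" and "0 < \<delta>"
    and V: "open V" "\<And>w. w \<in> D \<Longrightarrow> ball w \<delta> \<subseteq> V" and D[measurable]: "D \<in> sets borel"
    and g: "g holomorphic_on V" "\<And>w. w \<in> V \<Longrightarrow> cmod (g w) \<le> C"
    and H[measurable]: "H \<in> borel_measurable borel" and HC: "\<And>w. \<bar>H w\<bar> \<le> C"
    and Hg: "\<And>w. w \<in> V \<Longrightarrow> H w = Re (g w)"
  defines "X \<equiv> \<lambda>k \<omega>. B (real k * \<epsilon>) \<omega>"
  shows "\<bar>(\<integral>\<omega>. H (X (exit_index D (\<lambda>k. X k \<omega>) (Suc N)) \<omega>) \<partial>M) -
      (\<integral>\<omega>. H (X (exit_index D (\<lambda>k. X k \<omega>) N) \<omega>) \<partial>M)\<bar> \<le> 192 * C / \<delta> ^ 3 * (16 * sqrt \<epsilon> ^ 3)"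
proof -
  interpret prob_space M using bm unfolding planar_brownian_motion_def by blast
  have X[measurable]: "X k \<in> borel_measurable M" for k
    using bm \<open>0 < \<epsilon>\<close> unfolding planar_brownian_motion_def X_def by auto
  have "0 \<le> C" using HC[of 0] by linarith
  define I where "I i \<omega> = X (Suc i) \<omega> - X i \<omega>" for i \<omega>
  have sum_I: "(\<Sum>i<l. I i \<omega>) = X l \<omega> - X 0 \<omega>" for l \<omega>
    unfolding I_def by (rule sum_lessThan_telescope)
  have X0: "AE \<omega> in M. X 0 \<omega> = z" using bm unfolding planar_brownian_motion_def X_def by auto
  have ind: "indep_vars (\<lambda>_. borel) I {..<Suc N}"
  proof -
    have "\<forall>m (s :: nat \<Rightarrow> real). 0 \<le> s 0 \<and> (\<forall>i<m. s i \<le> s (Suc i)) \<longrightarrow>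
        indep_vars (\<lambda>_. borel) (\<lambda>i \<omega>. B (s (Suc i)) \<omega> - B (s i) \<omega>) {..<m}"
      using bm unfolding planar_brownian_motion_def by blast
    from this[rule_format, of "\<lambda>k. real k * \<epsilon>" "Suc N"] show ?thesis
      unfolding I_def X_def using \<open>0 < \<epsilon>\<close> by simp
  qed
  define P where "P = PiM {..<N} (\<lambda>_. borel :: complex measure)"
  define Y where "Y \<omega> = restrict (\<lambda>i. I i \<omega>) {..<N}" for \<omega>
  define Z where "Z \<omega> = restrict (\<lambda>i. I i \<omega>) {N}" for \<omega>
  have indep: "indep_var P Y (PiM {N} (\<lambda>_. borel)) Z"
    unfolding P_def Y_def[abs_def] Z_def[abs_def] by (rule indep_var_restrict[OF ind]) auto
  \<comment> \<open>The position at step \<open>l\<close>, rebuilt from the increments alone. It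
    agrees with \<open>X l\<close> only almost surely, since \<open>B 0 = z\<close> is an almost
    sure statement.\<close>
  define q where "q l y = z + (\<Sum>i<l. y i)" for l and y :: "nat \<Rightarrow> complex"
  have qm[measurable]: "q l \<in> borel_measurable P" if "l \<le> N" for l
    unfolding q_def P_def using that by (intro borel_measurable_add borel_measurable_sum) auto
  define A where "A = {y \<in> space P. \<forall>l\<in>{..N}. q l y \<in> D}"
  have A: "A \<in> sets P" unfolding A_def by measurable
  have q_eq: "q l (Y \<omega>) = X l \<omega>" if "l \<le> N" "X 0 \<omega> = z" for l \<omega>
  proof -
    have "(\<Sum>i<l. Y \<omega> i) = (\<Sum>i<l. I i \<omega>)" using that by (intro sum.cong) (auto simp: Y_def)
    then show ?thesis using that sum_I by (simp add: q_def)
  qed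
  \<comment> \<open>The Taylor coefficients are cut off outside \<open>D\<close>: inside
    \<open>D\<close> a ball of radius \<delta> fits into \<open>V\<close> and bounds them uniformly,
    and outside \<open>V\<close> the derivatives of \<open>g\<close> mean nothing.\<close>
  define a where "a w = (if w \<in> D then deriv g w else 0)" for w
  define b where "b w = (if w \<in> D then (deriv ^^ 2) g w / 2 else 0)" for w
  have DV: "D \<subseteq> V" using V(2) \<open>0 < \<delta>\<close> centre_in_ball by blast
  have "continuous_on D (deriv g)" "continuous_on D (\<lambda>w. (deriv ^^ 2) g w / 2)"
    using DV holomorphic_on_imp_continuous_on[OF holomorphic_higher_deriv[OF g(1) \<open>open V\<close>]]
      holomorphic_on_imp_continuous_on[OF holomorphic_deriv[OF g(1) \<open>open V\<close>]]
    by (auto intro!: continuous_intros intro: continuous_on_subset)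
  then have [measurable]: "a \<in> borel_measurable borel" "b \<in> borel_measurable borel"
    unfolding a_def b_def by (auto intro!: borel_measurable_continuous_on_if)
  have Tay: "cmod (deriv g w) \<le> 2 * C / \<delta>" "cmod ((deriv ^^ 2) g w) \<le> 8 * C / \<delta>\<^sup>2"
    "\<bar>H (w + x) - H w - Re (deriv g w * x + (deriv ^^ 2) g w / 2 * x\<^sup>2)\<bar>
      \<le> 192 * C / \<delta> ^ 3 * cmod x ^ 3" if "w \<in> D" for w x
  proof -
    have "g holomorphic_on ball w \<delta>" using g(1) V(2)[OF that] by (rule holomorphic_on_subset)
    note * = Re_holomorphic_Taylor_bound[where H = H, OF \<open>0 < \<delta>\<close> this g(2) HC Hg]
    show "cmod (deriv g w) \<le> 2 * C / \<delta>" "cmod ((deriv ^^ 2) g w) \<le> 8 * C / \<delta>\<^sup>2"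
      "\<bar>H (w + x) - H w - Re (deriv g w * x + (deriv ^^ 2) g w / 2 * x\<^sup>2)\<bar>
      \<le> 192 * C / \<delta> ^ 3 * cmod x ^ 3" using * V(2)[OF that] by blast+
  qed
  define K' where "K' = max (2 * C / \<delta>) (8 * C / \<delta>\<^sup>2 / 2)"
  have K': "cmod (a w) \<le> K'" "cmod (b w) \<le> K'" for w
  proof -
    have "0 \<le> K'" using \<open>0 \<le> C\<close> \<open>0 < \<delta>\<close> by (simp add: K'_def le_max_iff_disj)
    then show "cmod (a w) \<le> K'" "cmod (b w) \<le> K'"
      using Tay(1,2)[of w] unfolding a_def b_def K'_def by (auto simp: norm_divide)
  qed
  have I: "I N = (\<lambda>\<omega>. Z \<omega> N)" by (auto simp: Z_def)
  have le: "0 \<le> real N * \<epsilon>" "real N * \<epsilon> < real (Suc N) * \<epsilon>" using \<open>0 < \<epsilon>\<close> by auto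
  have mom: "integrable M (I N)" "(\<integral>\<omega>. I N \<omega> \<partial>M) = 0"
    "integrable M (\<lambda>\<omega>. (I N \<omega>)\<^sup>2)" "(\<integral>\<omega>. (I N \<omega>)\<^sup>2 \<partial>M) = 0"
    "integrable M (\<lambda>\<omega>. cmod (I N \<omega>) ^ 3)" "(\<integral>\<omega>. cmod (I N \<omega>) ^ 3 \<partial>M) \<le> 16 * sqrt \<epsilon> ^ 3"
    using planar_brownian_motion_increment_moments[OF bm le]
    unfolding I_def X_def by (simp_all add: algebra_simps)
  define W where "W n \<omega> = H (X (exit_index D (\<lambda>k. X k \<omega>) n) \<omega>)" for n \<omega>
  have Wm[measurable]: "W n \<in> borel_measurable M" for n
    unfolding W_def using exit_value_measurable[OF X D, where N = n] by measurable
  have Wi: "integrable M (W n)" for n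
    by (rule integrable_const_bound[where B = C]) (auto simp: W_def HC)
  have "AE \<omega> in M. W (Suc N) \<omega> - W N \<omega> =
      indicator A (Y \<omega>) * (H (q N (Y \<omega>) + Z \<omega> N) - H (q N (Y \<omega>)))"
    using X0
  proof eventually_elim
    case (elim \<omega>)
    have sp: "Y \<omega> \<in> space P" by (auto simp: Y_def P_def space_PiM)
    have iff: "Y \<omega> \<in> A \<longleftrightarrow> (\<forall>l\<le>N. X l \<omega> \<in> D)"
      using sp q_eq[OF _ elim] by (auto simp: A_def)
    show ?case
    proof (cases "Y \<omega> \<in> A")
      case True
      then have "exit_index D (\<lambda>k. X k \<omega>) N = N" using iff by (intro exit_index_eq) auto
      moreover have "X (Suc N) \<omega> = X N \<omega> + Z \<omega> N" by (simp add: Z_def I_def)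
      ultimately show ?thesis using True iff q_eq[OF order_refl elim] by (simp add: W_def)
    qed (use iff in \<open>auto simp: W_def\<close>)
  qed
  then have "(\<integral>\<omega>. W (Suc N) \<omega> - W N \<omega> \<partial>M) =
      (\<integral>\<omega>. indicator A (Y \<omega>) * (H (q N (Y \<omega>) + Z \<omega> N) - H (q N (Y \<omega>))) \<partial>M)"
  proof (rule integral_cong_AE[rotated 2])
    have [measurable]: "Y \<in> measurable M P" "Z \<in> measurable M (PiM {N} (\<lambda>_. borel))"
      using indep unfolding indep_var_eq by auto
    have [measurable]: "q N \<in> borel_measurable P" by (rule qm) simp
    show "(\<lambda>\<omega>. indicator A (Y \<omega>) * (H (q N (Y \<omega>) + Z \<omega> N) - H (q N (Y \<omega>)))) \<in> borel_measurable M"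
      using A by measurable
  qed measurable
  also have "\<bar>\<dots>\<bar> \<le> 192 * C / \<delta> ^ 3 * (\<integral>\<omega>. cmod (Z \<omega> N) ^ 3 \<partial>M)"
  proof (rule indep_Taylor_step[OF indep _ A qm[OF order_refl] _ _ H K'])
    fix y x assume "y \<in> A"
    then have "q N y \<in> D" by (auto simp: A_def)
    then show "\<bar>H (q N y + x) - H (q N y) - Re (a (q N y) * x + b (q N y) * x\<^sup>2)\<bar>
      \<le> 192 * C / \<delta> ^ 3 * cmod x ^ 3" using Tay(3)[of "q N y" x] by (simp add: a_def b_def)
  qed (use mom[unfolded I] HC \<open>0 \<le> C\<close> \<open>0 < \<delta>\<close> in auto)
  also have "\<dots> \<le> 192 * C / \<delta> ^ 3 * (16 * sqrt \<epsilon> ^ 3)"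
    using mom(6) \<open>0 \<le> C\<close> \<open>0 < \<delta>\<close> unfolding I by (intro mult_left_mono) auto
  finally show ?thesis unfolding Bochner_Integration.integral_diff[OF Wi Wi] by (simp only: W_def[abs_def])
qed

text \<open>The one-step errors telescope. For mesh \<epsilon> = 2^(-j) and N = m * 2^j the total is
  of order 2^(-j/2) for fixed \<open>m\<close> and \<delta>, so it vanishes under
  refinement.\<close>

lemma planar_brownian_motion_exit_estimate:
  fixes g :: "complex \<Rightarrow> complex" and H :: "complex \<Rightarrow> real"
  assumes bm: "planar_brownian_motion M B z" and "0 < \<epsilon>" and "0 < \<delta>"
    and V: "open V" "\<And>w. w \<in> D \<Longrightarrow> ball w \<delta> \<subseteq> V" and D[measurable]: "D \<in> sets borel"
    and g: "g holomorphic_on V" "\<And>w. w \<in> V \<Longrightarrow> cmod (g w) \<le> C"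
    and H[measurable]: "H \<in> borel_measurable borel" and HC: "\<And>w. \<bar>H w\<bar> \<le> C"
    and Hg: "\<And>w. w \<in> V \<Longrightarrow> H w = Re (g w)"
  defines "X \<equiv> \<lambda>k \<omega>. B (real k * \<epsilon>) \<omega>"
  shows "\<bar>(\<integral>\<omega>. H (X (exit_index D (\<lambda>k. X k \<omega>) N) \<omega>) \<partial>M) - H z\<bar>
    \<le> real N * (192 * C / \<delta> ^ 3 * (16 * sqrt \<epsilon> ^ 3))"
proof (induction N)
  case 0
  interpret prob_space M using bm unfolding planar_brownian_motion_def by blast
  have X[measurable]: "X 0 \<in> borel_measurable M"
    using bm unfolding planar_brownian_motion_def X_def by auto
  have "AE \<omega> in M. H (X 0 \<omega>) = H z"
    using bm unfolding planar_brownian_motion_def X_def by auto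
  then have "(\<integral>\<omega>. H (X 0 \<omega>) \<partial>M) = (\<integral>\<omega>. H z \<partial>M)" by (intro integral_cong_AE) auto
  then show ?case by (simp add: prob_space)
next
  case (Suc N)
  have "\<bar>(\<integral>\<omega>. H (X (exit_index D (\<lambda>k. X k \<omega>) (Suc N)) \<omega>) \<partial>M) -
      (\<integral>\<omega>. H (X (exit_index D (\<lambda>k. X k \<omega>) N) \<omega>) \<partial>M)\<bar> \<le> 192 * C / \<delta> ^ 3 * (16 * sqrt \<epsilon> ^ 3)"
    unfolding X_def by (rule planar_brownian_motion_exit_step[OF assms(1-11)])
  moreover have *: "real (Suc N) * K = real N * K + K" for K :: real by (simp add: algebra_simps)
  ultimately show ?case using Suc unfolding * by linarith
qed

section \<open>First hitting times and their dyadic approximation\<close>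

lemma first_hitting_time:
  fixes b :: "real \<Rightarrow> 'b::t2_space"
  assumes b: "continuous_on {0..} b" and "closed F" and t0: "0 \<le> t0" "b t0 \<in> F"
  defines "\<tau> \<equiv> LEAST t. 0 \<le> t \<and> b t \<in> F"
  shows "0 \<le> \<tau>" "b \<tau> \<in> F" "\<And>t. 0 \<le> t \<Longrightarrow> b t \<in> F \<Longrightarrow> \<tau> \<le> t"
proof -
  \<comment> \<open>On the reals \<open>LEAST\<close> is meaningful only if a minimum is attained.
    It is, because the hitting times up to the known one \<open>t0\<close> form a nonempty compact
    set.\<close>
  have "closed ({0..t0} \<inter> b -` F)"
    by (rule continuous_closed_preimage[OF continuous_on_subset[OF b]]) (use \<open>closed F\<close> in auto)
  then have "compact ({0..t0} \<inter> b -` F)"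
    by (metis Int_left_absorb compact_Icc compact_Int_closed)
  moreover have "{0..t0} \<inter> b -` F \<noteq> {}" using t0 by auto
  ultimately obtain s where s: "s \<in> {0..t0} \<inter> b -` F" "\<And>t. t \<in> {0..t0} \<inter> b -` F \<Longrightarrow> s \<le> t"
    using compact_attains_inf by metis
  have "s \<le> t" if "0 \<le> t" "b t \<in> F" for t
    using s(1) s(2)[of t] that by (cases "t \<le> t0") auto
  then have "\<tau> = s" unfolding \<tau>_def using s(1) by (intro Least_equality) auto
  then show "0 \<le> \<tau>" "b \<tau> \<in> F" "\<And>t. 0 \<le> t \<Longrightarrow> b t \<in> F \<Longrightarrow> \<tau> \<le> t"
    using s \<open>\<And>t. 0 \<le> t \<Longrightarrow> b t \<in> F \<Longrightarrow> s \<le> t\<close> by auto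
qed

text \<open>\<open>m\<close> plays two roles, as the time horizon and, through
  \<open>1 / Suc m\<close>, as the distance from \<open>F\<close> at which the process is stopped;
  \<open>j\<close> fixes the mesh. Before stopping, a ball of fixed radius around the position
  avoids \<open>F\<close>, which is what the Taylor bound requires.\<close>

definition dyadic_exit_time :: "'b::metric_space set \<Rightarrow> (real \<Rightarrow> 'b) \<Rightarrow> nat \<Rightarrow> nat \<Rightarrow> real" where
  "dyadic_exit_time F b m j =
     real (exit_index {w. infdist w F > 1 / Suc m} (\<lambda>k. b (real k * (1 / 2 ^ j))) (m * 2 ^ j)) * (1 / 2 ^ j)"

lemma dyadic_exit_time_bounds: "0 \<le> dyadic_exit_time F b m j" "dyadic_exit_time F b m j \<le> m"
proof -
  have "real (exit_index {w. infdist w F > 1 / Suc m} (\<lambda>k. b (real k * (1 / 2 ^ j))) (m * 2 ^ j)) \<le> real (m * 2 ^ j)"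
    by (simp only: of_nat_le_iff exit_index_le)
  then show "dyadic_exit_time F b m j \<le> m" by (simp add: dyadic_exit_time_def field_simps)
qed (simp add: dyadic_exit_time_def)

lemma dyadic_exit_time_cases:
  "dyadic_exit_time F b m j = m \<or> infdist (b (dyadic_exit_time F b m j)) F \<le> 1 / Suc m"
proof -
  let ?e = "exit_index {w. infdist w F > 1 / Suc m} (\<lambda>k. b (real k * (1 / 2 ^ j))) (m * 2 ^ j)"
  consider "?e = m * 2 ^ j" | "?e < m * 2 ^ j"
    using exit_index_le[of "{w. infdist w F > 1 / Suc m}" "\<lambda>k. b (real k * (1 / 2 ^ j))" "m * 2 ^ j"] by linarith
  then show ?thesis
  proof cases
    case 1 then show ?thesis by (simp add: dyadic_exit_time_def)
  next
    case 2
    from exit_index_exits[OF this] show ?thesis by (simp add: dyadic_exit_time_def not_less)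
  qed
qed

lemma dyadic_exit_time_leI:
  assumes "infdist (b (real k * (1 / 2 ^ j))) F \<le> 1 / Suc m"
  shows "dyadic_exit_time F b m j \<le> real k * (1 / 2 ^ j)"
proof -
  have "exit_index {w. infdist w F > 1 / Suc m} (\<lambda>k. b (real k * (1 / 2 ^ j))) (m * 2 ^ j) \<le> k"
    by (rule exit_index_leI) (use assms in \<open>simp add: not_less\<close>)
  then show ?thesis
    unfolding dyadic_exit_time_def by (intro mult_right_mono) auto
qed

text \<open>The finer grid contains the coarser one, so refinement can only detect closeness to
  \<open>F\<close> earlier. This monotonicity gives the limit in \<open>j\<close>.\<close>

lemma dyadic_exit_time_Suc: "dyadic_exit_time F b m (Suc j) \<le> dyadic_exit_time F b m j"
proof -
  let ?e = "exit_index {w. infdist w F > 1 / Suc m} (\<lambda>k. b (real k * (1 / 2 ^ j))) (m * 2 ^ j)"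
  have eq: "dyadic_exit_time F b m j = real (2 * ?e) * (1 / 2 ^ Suc j)"
    by (simp add: dyadic_exit_time_def)
  show ?thesis
    using dyadic_exit_time_cases[of F b m j]
  proof
    assume "dyadic_exit_time F b m j = m"
    then show ?thesis using dyadic_exit_time_bounds(2)[of F b m "Suc j"] by simp
  next
    assume "infdist (b (dyadic_exit_time F b m j)) F \<le> 1 / Suc m"
    then show ?thesis unfolding eq by (rule dyadic_exit_time_leI)
  qed
qed

text \<open>The limit \<open>s m\<close> need not be the first time at distance at most
  \<open>1 / Suc m\<close>, since a path may touch that level between grid points. Two bounds are
  enough. Above, \<open>s m \<le> \<tau>\<close>, as grid points close to \<tau> eventually come
  within the margin. Below, for v < \<tau> the distance to \<open>F\<close> has a positive minimum
  on [0, v], so no stopping happens before v once \<open>m\<close> is large.\<close>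

lemma dyadic_exit_time_limit:
  fixes b :: "real \<Rightarrow> 'b::metric_space"
  assumes b: "continuous_on {0..} b" and F: "closed F" and t0: "0 \<le> t0" "b t0 \<in> F"
  defines "\<tau> \<equiv> LEAST t. 0 \<le> t \<and> b t \<in> F"
  obtains s where "\<And>m. dyadic_exit_time F b m \<longlonglongrightarrow> s m" "\<And>m. 0 \<le> s m" "s \<longlonglongrightarrow> \<tau>"
proof -
  note \<tau> = first_hitting_time[OF b F t0, folded \<tau>_def]
  define s where "s m = lim (dyadic_exit_time F b m)" for m
  have s: "dyadic_exit_time F b m \<longlonglongrightarrow> s m" for m
  proof -
    have "decseq (dyadic_exit_time F b m)" using dyadic_exit_time_Suc by (rule decseq_SucI)
    then have "convergent (dyadic_exit_time F b m)"
    proof (rule decseq_convergent)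
      show "\<forall>i. 0 \<le> dyadic_exit_time F b m i" using dyadic_exit_time_bounds(1) by blast
    qed (auto simp: convergent_def)
    then show ?thesis unfolding s_def by (simp add: convergent_LIMSEQ_iff)
  qed
  have s0: "0 \<le> s m" for m
    using s[of m] by (rule LIMSEQ_le_const) (use dyadic_exit_time_bounds(1) in blast)
  have cinf: "continuous_on {0..} (\<lambda>t. infdist (b t) F)" by (intro continuous_intros b)
  have upper: "s m \<le> \<tau>" for m
  proof -
    \<comment> \<open>Grid points approaching \<tau> from below; along them the distance to
      \<open>F\<close> tends to 0.\<close>
    have lim: "(\<lambda>j. real (nat \<lfloor>\<tau> * 2 ^ j\<rfloor>) * (1 / 2 ^ j)) \<longlonglongrightarrow> \<tau>"
    proof (rule tendsto_sandwich[where f = "\<lambda>j. \<tau> - 1 / 2 ^ j" and h = "\<lambda>j. \<tau>"])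
      have "(\<lambda>j. \<tau> - (1 / 2) ^ j) \<longlonglongrightarrow> \<tau> - 0"
        by (intro tendsto_diff tendsto_const LIMSEQ_realpow_zero) auto
      then show "(\<lambda>j. \<tau> - 1 / 2 ^ j) \<longlonglongrightarrow> \<tau>" by (simp add: power_divide)
      have "\<tau> - 1 / 2 ^ j \<le> real (nat \<lfloor>\<tau> * 2 ^ j\<rfloor>) * (1 / 2 ^ j) \<and> real (nat \<lfloor>\<tau> * 2 ^ j\<rfloor>) * (1 / 2 ^ j) \<le> \<tau>" for j
      proof -
        have "real (nat \<lfloor>\<tau> * 2 ^ j\<rfloor>) = of_int \<lfloor>\<tau> * 2 ^ j\<rfloor>" using \<tau>(1) by simp
        then have "\<tau> * 2 ^ j - 1 \<le> real (nat \<lfloor>\<tau> * 2 ^ j\<rfloor>)" "real (nat \<lfloor>\<tau> * 2 ^ j\<rfloor>) \<le> \<tau> * 2 ^ j"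
          by linarith+
        then show ?thesis by (simp add: pos_le_divide_eq pos_divide_le_eq left_diff_distrib)
      qed
      then show "\<forall>\<^sub>F j in sequentially. \<tau> - 1 / 2 ^ j \<le> real (nat \<lfloor>\<tau> * 2 ^ j\<rfloor>) * (1 / 2 ^ j)"
        "\<forall>\<^sub>F j in sequentially. real (nat \<lfloor>\<tau> * 2 ^ j\<rfloor>) * (1 / 2 ^ j) \<le> \<tau>" by auto
    qed auto
    have "(\<lambda>j. infdist (b (real (nat \<lfloor>\<tau> * 2 ^ j\<rfloor>) * (1 / 2 ^ j))) F) \<longlonglongrightarrow> infdist (b \<tau>) F"
      by (rule continuous_on_tendsto_compose[OF cinf lim]) (use \<tau>(1) in auto)
    then have "(\<lambda>j. infdist (b (real (nat \<lfloor>\<tau> * 2 ^ j\<rfloor>) * (1 / 2 ^ j))) F) \<longlonglongrightarrow> 0" using \<tau>(2) by simp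
    then have "\<forall>\<^sub>F j in sequentially. infdist (b (real (nat \<lfloor>\<tau> * 2 ^ j\<rfloor>) * (1 / 2 ^ j))) F < 1 / Suc m"
      by (rule order_tendstoD) simp
    then have "\<forall>\<^sub>F j in sequentially. dyadic_exit_time F b m j \<le> real (nat \<lfloor>\<tau> * 2 ^ j\<rfloor>) * (1 / 2 ^ j)"
      by eventually_elim (intro dyadic_exit_time_leI less_imp_le)
    from tendsto_le[OF _ lim s this] show ?thesis by simp
  qed
  have "s \<longlonglongrightarrow> \<tau>"
  proof (rule order_tendstoI)
    fix u assume "u < \<tau>"
    define v where "v = (max 0 u + \<tau>) / 2"
    show "\<forall>\<^sub>F m in sequentially. u < s m"
    proof (cases "\<tau> = 0")
      case True
      then show ?thesis using \<open>u < \<tau>\<close> by (intro always_eventually allI less_le_trans[OF _ s0]) simp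
    next
      case False
      then have v: "0 \<le> v" "u < v" "v < \<tau>" using \<open>u < \<tau>\<close> \<tau>(1) by (auto simp: v_def)
      have ne: "F \<noteq> {}" using t0 by auto
      obtain x where x: "x \<in> {0..v}" "\<And>y. y \<in> {0..v} \<Longrightarrow> infdist (b x) F \<le> infdist (b y) F"
        using continuous_attains_inf[of "{0..v}" "\<lambda>t. infdist (b t) F"] continuous_on_subset[OF cinf] v(1) by auto
      have "b x \<notin> F" using \<tau>(3)[of x] x(1) v by auto
      then have "0 < infdist (b x) F" using F ne infdist_pos_not_in_closed by blast
      then have "\<forall>\<^sub>F m in sequentially. 1 / real (Suc m) < infdist (b x) F"
        using order_tendstoD(2)[OF LIMSEQ_inverse_real_of_nat] by (simp add: divide_inverse)
      moreover have "\<forall>\<^sub>F m in sequentially. v \<le> real m"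
        using filterlim_real_sequentially by (simp add: filterlim_at_top)
      ultimately show ?thesis
      proof eventually_elim
        case (elim m)
        have "v \<le> dyadic_exit_time F b m j" for j
          using dyadic_exit_time_cases[of F b m j] dyadic_exit_time_bounds(1)[of F b m j]
            x(2)[of "dyadic_exit_time F b m j"] elim by force
        then have "v \<le> s m" using s[of m] by (intro LIMSEQ_le_const) auto
        then show ?case using v by simp
      qed
    qed
  next
    fix u assume "\<tau> < u"
    then show "\<forall>\<^sub>F m in sequentially. s m < u" by (intro always_eventually allI le_less_trans[OF upper])
  qed
  with s s0 that show thesis by blast
qed

text \<open>
  Only discrete stopping is used: the exit point is a double limit of the process stopped at dyadic
  times, and each dyadic step changes the expectation of \<open>H\<close> by an error of order
  \<open>2 powr (- 3 * j / 2)\<close>, because an increment \<open>X\<close> has \<open>E X = E (X\<^sup>2) = 0\<close>.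
\<close>

theorem planar_brownian_motion_exit_point:
  fixes z :: complex
  assumes bm: "planar_brownian_motion M B z" and V: "open V"
    and exit: "AE \<omega> in M. \<exists>t\<ge>0. B t \<omega> \<notin> V"
  obtains P where "P \<in> borel_measurable M"
    "AE \<omega> in M. P \<omega> = B (LEAST t. 0 \<le> t \<and> B t \<omega> \<notin> V) \<omega>"
    "\<And>H g C. continuous_on UNIV H \<Longrightarrow> (\<And>w. \<bar>H w\<bar> \<le> C) \<Longrightarrow> g holomorphic_on V \<Longrightarrow>
       (\<And>w. w \<in> V \<Longrightarrow> cmod (g w) \<le> C) \<Longrightarrow> (\<And>w. w \<in> V \<Longrightarrow> H w = Re (g w)) \<Longrightarrow>
       (\<integral>\<omega>. H (P \<omega>) \<partial>M) = H z"
proof -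
  interpret prob_space M using bm unfolding planar_brownian_motion_def by blast
  define F where "F = - V"
  have F: "closed F" using V unfolding F_def by (rule closed_Compl)
  define D where "D m = {w. infdist w F > 1 / Suc m}" for m
  have [measurable]: "D m \<in> sets borel" for m
    unfolding D_def by (intro borel_open open_Collect_less continuous_intros)
  define s where "s m j \<omega> = dyadic_exit_time F (\<lambda>t. B t \<omega>) m j" for m j \<omega>
  define Q where "Q m j \<omega> = B (s m j \<omega>) \<omega>" for m j \<omega>
  have Qm[measurable]: "Q m j \<in> borel_measurable M" for m j
    unfolding Q_def s_def dyadic_exit_time_def D_def[symmetric]
    by (rule exit_value_measurable) (use bm in \<open>auto simp: planar_brownian_motion_def\<close>)
  \<comment> \<open>Taking \<open>lim\<close> pointwise gives Borel measurable \<open>R\<close> and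
    \<open>P\<close> everywhere, even on the null set where the limits fail to exist. Thus
    \<open>P\<close> is a measurable version of the exit point, fixed before any test function
    \<open>H\<close> is chosen.\<close>
  define R where "R m \<omega> = lim (\<lambda>j. Q m j \<omega>)" for m \<omega>
  define P where "P \<omega> = lim (\<lambda>m. R m \<omega>)" for \<omega>
  have Rm[measurable]: "R m \<in> borel_measurable M" for m unfolding R_def by measurable
  have Pm[measurable]: "P \<in> borel_measurable M" unfolding P_def by measurable
  have "AE \<omega> in M. (\<forall>m. (\<lambda>j. Q m j \<omega>) \<longlonglongrightarrow> R m \<omega>) \<and> (\<lambda>m. R m \<omega>) \<longlonglongrightarrow> P \<omega> \<and>
      P \<omega> = B (LEAST t. 0 \<le> t \<and> B t \<omega> \<notin> V) \<omega>"
  proof -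
    have "AE \<omega> in M. continuous_on {0..} (\<lambda>t. B t \<omega>)"
      using bm unfolding planar_brownian_motion_def by blast
    with exit show ?thesis
    proof eventually_elim
      case (elim \<omega>)
      then obtain t0 where t0: "0 \<le> t0" "B t0 \<omega> \<in> F" by (auto simp: F_def)
      define \<tau> where "\<tau> = (LEAST t. 0 \<le> t \<and> B t \<omega> \<notin> V)"
      have \<tau>: "\<tau> = (LEAST t. 0 \<le> t \<and> B t \<omega> \<in> F)" by (simp add: \<tau>_def F_def)
      obtain s' where s': "\<And>m. dyadic_exit_time F (\<lambda>t. B t \<omega>) m \<longlonglongrightarrow> s' m" "\<And>m. 0 \<le> s' m" "s' \<longlonglongrightarrow> \<tau>"
        using dyadic_exit_time_limit[OF elim(2) F t0] unfolding \<tau> by blast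
      have "0 \<le> \<tau>" unfolding \<tau> by (rule first_hitting_time[OF elim(2) F t0])
      have Q: "(\<lambda>j. Q m j \<omega>) \<longlonglongrightarrow> B (s' m) \<omega>" for m
        unfolding Q_def s_def using s'(2)
        by (intro continuous_on_tendsto_compose[OF elim(2) s'(1)] always_eventually)
           (auto simp: dyadic_exit_time_bounds)
      then have R: "R m \<omega> = B (s' m) \<omega>" for m unfolding R_def by (rule limI)
      have "(\<lambda>m. R m \<omega>) \<longlonglongrightarrow> B \<tau> \<omega>"
        unfolding R using s'(2) \<open>0 \<le> \<tau>\<close>
        by (intro continuous_on_tendsto_compose[OF elim(2) s'(3)]) auto
      moreover from this have "P \<omega> = B \<tau> \<omega>" unfolding P_def by (rule limI)
      ultimately show ?case using Q R by (simp add: \<tau>_def)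
    qed
  qed
  then have lims: "AE \<omega> in M. \<forall>m. (\<lambda>j. Q m j \<omega>) \<longlonglongrightarrow> R m \<omega>" "AE \<omega> in M. (\<lambda>m. R m \<omega>) \<longlonglongrightarrow> P \<omega>"
    and P: "AE \<omega> in M. P \<omega> = B (LEAST t. 0 \<le> t \<and> B t \<omega> \<notin> V) \<omega>" by auto
  show thesis
  proof (rule that[OF Pm P])
    fix H :: "complex \<Rightarrow> real" and g C
    assume H: "continuous_on UNIV H" and HC: "\<And>w. \<bar>H w\<bar> \<le> C" and g: "g holomorphic_on V"
      "\<And>w. w \<in> V \<Longrightarrow> cmod (g w) \<le> C" "\<And>w. w \<in> V \<Longrightarrow> H w = Re (g w)"
    have [measurable]: "H \<in> borel_measurable borel" using H by (rule borel_measurable_continuous_onI)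
    have HT: "(\<lambda>j. H (x j)) \<longlonglongrightarrow> H y" if "x \<longlonglongrightarrow> y" for x y
      using continuous_on_tendsto_compose[OF H that] by simp
    have "(\<integral>\<omega>. H (R m \<omega>) \<partial>M) = H z" for m
    proof -
      have "(\<lambda>j. \<integral>\<omega>. H (Q m j \<omega>) \<partial>M) \<longlonglongrightarrow> (\<integral>\<omega>. H (R m \<omega>) \<partial>M)"
        by (rule integral_dominated_convergence[where w = "\<lambda>_. C"])
           (use lims(1) HC in \<open>auto intro!: HT elim!: eventually_mono\<close>)
      moreover have "(\<lambda>j. \<integral>\<omega>. H (Q m j \<omega>) \<partial>M) \<longlonglongrightarrow> H z"
      proof (rule LIM_zero_cancel, rule Lim_null_comparison)
        show "\<forall>\<^sub>F j in sequentially. norm ((\<integral>\<omega>. H (Q m j \<omega>) \<partial>M) - H z) \<le>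
          real m * 192 * C * real (Suc m) ^ 3 * 16 * sqrt ((1 / 2) ^ j)"
        proof (rule always_eventually, rule allI)
          fix j
          have ball: "ball w (1 / Suc m) \<subseteq> V" if "w \<in> D m" for w
          proof
            fix u assume u: "u \<in> ball w (1 / Suc m)"
            show "u \<in> V"
            proof (rule ccontr)
              assume "u \<notin> V"
              then have "infdist w F \<le> dist w u" by (intro infdist_le) (simp add: F_def)
              then show False using u that by (simp add: D_def)
            qed
          qed
          \<comment> \<open>There are m * 2^j steps, each with an error proportional to q^3, where q
            = 2^(-j/2); the identity 2^j * q^3 = q leaves a total that tends to 0.\<close>
          define q where "q = sqrt ((1 / 2) ^ j)"
          have q: "2 ^ j * q ^ 3 = q"
          proof -
            have "2 ^ j * q ^ 3 = (2 ^ j * q ^ 2) * q" by (simp add: power2_eq_square power3_eq_cube)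
            also have "2 ^ j * q ^ 2 = 1" by (simp add: q_def power_divide)
            finally show ?thesis by simp
          qed
          have "\<bar>(\<integral>\<omega>. H (Q m j \<omega>) \<partial>M) - H z\<bar> \<le> real (m * 2 ^ j) * (192 * C / (1 / Suc m) ^ 3 * (16 * sqrt (1 / 2 ^ j) ^ 3))"
            unfolding Q_def s_def dyadic_exit_time_def D_def[symmetric]
            by (rule planar_brownian_motion_exit_estimate[OF bm _ _ V ball _ g(1,2) _ HC g(3)]) auto
          also have "\<dots> = real m * 192 * C * real (Suc m) ^ 3 * 16 * (2 ^ j * q ^ 3)"
            by (simp add: q_def power_divide)
          finally show "norm ((\<integral>\<omega>. H (Q m j \<omega>) \<partial>M) - H z) \<le>
            real m * 192 * C * real (Suc m) ^ 3 * 16 * sqrt ((1 / 2) ^ j)" unfolding q by (simp add: q_def)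
        qed
        have "(\<lambda>j. sqrt ((1 / 2) ^ j)) \<longlonglongrightarrow> sqrt 0"
          by (intro tendsto_real_sqrt LIMSEQ_realpow_zero) auto
        then show "(\<lambda>j. real m * 192 * C * real (Suc m) ^ 3 * 16 * sqrt ((1 / 2) ^ j)) \<longlonglongrightarrow> 0"
          by (intro tendsto_mult_right_zero) simp
      qed
      ultimately show ?thesis by (rule LIMSEQ_unique)
    qed
    moreover have "(\<lambda>m. \<integral>\<omega>. H (R m \<omega>) \<partial>M) \<longlonglongrightarrow> (\<integral>\<omega>. H (P \<omega>) \<partial>M)"
      by (rule integral_dominated_convergence[where w = "\<lambda>_. C"])
         (use lims(2) HC in \<open>auto intro!: HT elim!: eventually_mono\<close>)
    ultimately show "(\<integral>\<omega>. H (P \<omega>) \<partial>M) = H z" by (simp add: LIMSEQ_const_iff)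
  qed
qed

section \<open>Almost sure exit from a lower half-plane\<close>

lemma (in prob_space) normal_tail_ge:
  assumes X: "distributed M lborel X (normal_density 0 \<sigma>)" and "0 < \<sigma>" and "a \<le> \<sigma>"
  shows "exp (- 2) / sqrt (2 * pi) \<le> prob {\<omega> \<in> space M. a \<le> X \<omega>}"
proof -
  have [measurable]: "X \<in> borel_measurable M" using distributed_measurable[OF X] by simp
  let ?d = "exp (- 2) / sqrt (2 * pi)"
  \<comment> \<open>On the interval from \<sigma> to 2 \<sigma> the density is at least
    \<open>exp (- 2) / sqrt (2 * pi)\<close> divided by \<sigma>. The length \<sigma> of the
    interval cancels the scale, so the tail bound does not depend on \<sigma>.\<close>
  have dens: "?d / \<sigma> \<le> normal_density 0 \<sigma> x" if "x \<in> {\<sigma>..2*\<sigma>}" for x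
  proof -
    have "x\<^sup>2 \<le> (2 * \<sigma>)\<^sup>2" using that \<open>0 < \<sigma>\<close> by (intro power_mono) auto
    then have "- 2 \<le> - (x\<^sup>2 / (2 * \<sigma>\<^sup>2))" using \<open>0 < \<sigma>\<close> by (simp add: field_simps)
    then have "exp (- 2) \<le> exp (- (x\<^sup>2 / (2 * \<sigma>\<^sup>2)))" by simp
    then show ?thesis using \<open>0 < \<sigma>\<close>
      by (simp add: normal_density_def real_sqrt_mult divide_right_mono field_simps)
  qed
  have "ennreal ?d = (\<integral>\<^sup>+x. ennreal (?d / \<sigma>) * indicator {\<sigma>..2*\<sigma>} x \<partial>lborel)"
    using \<open>0 < \<sigma>\<close> by (simp add: nn_integral_cmult_indicator ennreal_mult[symmetric])
  also have "\<dots> \<le> (\<integral>\<^sup>+x. ennreal (normal_density 0 \<sigma> x) * indicator {a..} x \<partial>lborel)"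
    using dens \<open>a \<le> \<sigma>\<close> by (intro nn_integral_mono) (auto split: split_indicator intro!: ennreal_leI)
  also have "\<dots> = emeasure M (X -` {a..} \<inter> space M)"
    by (rule distributed_emeasure[OF X, symmetric]) auto
  also have "X -` {a..} \<inter> space M = {\<omega> \<in> space M. a \<le> X \<omega>}" by auto
  finally show ?thesis by (simp add: emeasure_eq_measure)
qed

text \<open>
  Independent increments over rapidly growing time intervals: each block lifts the imaginary part
  above \<open>c\<close> with probability bounded below, unless it was far below at the start of the block.
\<close>

lemma planar_brownian_motion_exits_lower_half_plane:
  assumes bm: "planar_brownian_motion M B z"
  shows "AE \<omega> in M. \<exists>t\<ge>0. c \<le> Im (B t \<omega>)"
proof -
  interpret prob_space M using bm unfolding planar_brownian_motion_def by blast
  \<comment> \<open>The recursion inlines the \<open>K i\<close> defined next. The lengths make |c|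
    + K i + 1 the standard deviation of the i-th vertical increment, so the lift c + K i is within
    one standard deviation. In turn, K i exceeds |Im z| by at least 2^i standard deviations of the
    vertical displacement up to time \<open>T i\<close>, so Chebyshev's inequality gives (1/4)^i for
    \<open>G i\<close>.\<close>
  define T where "T = rec_nat (0::real) (\<lambda>i t. t + (\<bar>c\<bar> + (\<bar>Im z\<bar> + 2 ^ i * (sqrt t + 1)) + 1)\<^sup>2)"
  define K where "K i = \<bar>Im z\<bar> + 2 ^ i * (sqrt (T i) + 1)" for i
  have T0: "T 0 = 0" and TS: "T (Suc i) = T i + (\<bar>c\<bar> + K i + 1)\<^sup>2" for i
    by (simp_all add: T_def K_def)
  have Tnn: "0 \<le> T i" for i by (induction i) (auto simp: T0 TS)
  have K0: "0 \<le> K i" for i using Tnn[of i] by (simp add: K_def)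
  have Tmono: "T i < T (Suc i)" for i using K0[of i] by (simp add: TS)
  have Tpos: "0 < T i" if "0 < i" for i using that Tmono[of "i - 1"] Tnn[of "i - 1"] by simp
  have Bm[measurable]: "B (T i) \<in> borel_measurable M" for i
    using bm Tnn unfolding planar_brownian_motion_def by auto
  define p where "p = exp (- 2) / sqrt (2 * pi)"
  have p: "0 < p" by (simp add: p_def)
  define I where "I i \<omega> = B (T (Suc i)) \<omega> - B (T i) \<omega>" for i \<omega>
  define E where "E i = {\<omega> \<in> space M. c + K i \<le> Im (I i \<omega>)}" for i
  define G where "G i = {\<omega> \<in> space M. Im (B (T i) \<omega>) < - K i}" for i
  define A where "A = {\<omega> \<in> space M. \<forall>i. Im (B (T i) \<omega>) < c}"
  have [measurable]: "E i \<in> sets M" "G i \<in> sets M" "A \<in> sets M" for i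
    unfolding E_def G_def A_def I_def by measurable
  have pE: "p \<le> prob (E i)" for i
  proof -
    have "distributed M lborel (\<lambda>\<omega>. Im (I i \<omega>)) (normal_density 0 (sqrt (T (Suc i) - T i)))"
      using bm Tnn[of i] Tmono[of i] unfolding planar_brownian_motion_def I_def by auto
    moreover have "sqrt (T (Suc i) - T i) = \<bar>c\<bar> + K i + 1" using K0[of i] by (simp add: TS)
    ultimately show ?thesis
      unfolding p_def E_def using K0[of i] by (intro normal_tail_ge[where \<sigma> = "\<bar>c\<bar> + K i + 1"]) auto
  qed
  have pG: "prob (G i) \<le> (1 / 4) ^ i" if "0 < i" for i
  proof -
    define Y where "Y \<omega> = Im (B (T i) \<omega> - B 0 \<omega>)" for \<omega>
    have dY: "distributed M lborel Y (normal_density 0 (sqrt (T i)))"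
    proof -
      have "distributed M lborel (\<lambda>\<omega>. Im (B (T i) \<omega> - B 0 \<omega>)) (normal_density 0 (sqrt (T i - 0)))"
        using bm Tpos[OF that] unfolding planar_brownian_motion_def by blast
      then show ?thesis by (simp add: Y_def[abs_def])
    qed
    note mom = centered_normal_moments[OF dY]
    have q: "0 < 4 ^ i * T i" using Tpos[OF that] by simp
    have "prob (G i) \<le> prob {\<omega> \<in> space M. 4 ^ i * T i \<le> Y \<omega> ^ 2}"
    proof (rule finite_measure_mono_AE)
      have "AE \<omega> in M. B 0 \<omega> = z" using bm unfolding planar_brownian_motion_def by blast
      then show "AE \<omega> in M. \<omega> \<in> G i \<longrightarrow> \<omega> \<in> {\<omega> \<in> space M. 4 ^ i * T i \<le> (Y \<omega>)\<^sup>2}"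
        using AE_space
      proof eventually_elim
        case (elim \<omega>)
        show ?case
        proof
          assume "\<omega> \<in> G i"
          then have "2 ^ i * sqrt (T i) \<le> - Y \<omega>"
            using elim abs_ge_minus_self[of "Im z"]
            by (auto simp: G_def Y_def K_def algebra_simps) (smt (verit) zero_le_power)
          then have "(2 ^ i * sqrt (T i))\<^sup>2 \<le> (- Y \<omega>)\<^sup>2" using Tnn[of i] by (intro power_mono) auto
          moreover have "(2 ^ i * sqrt (T i))\<^sup>2 = 4 ^ i * T i"
            using Tnn[of i] by (simp add: power_mult_distrib flip: power_mult)
              (simp add: mult.commute[of i] power_mult)
          ultimately show "\<omega> \<in> {\<omega> \<in> space M. 4 ^ i * T i \<le> (Y \<omega>)\<^sup>2}" using elim by simp
        qed
      qed
      have [measurable]: "Y \<in> borel_measurable M" using distributed_measurable[OF dY] by simp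
      show "{\<omega> \<in> space M. 4 ^ i * T i \<le> (Y \<omega>)\<^sup>2} \<in> sets M" by measurable
    qed
    also have "\<dots> \<le> expectation (\<lambda>\<omega>. Y \<omega> ^ 2) / (4 ^ i * T i)"
      by (rule integral_Markov_inequality_measure[OF _ _ _ q, where A = "{}"]) (use mom Tpos[OF that] in auto)
    also have "\<dots> = (1 / 4) ^ i" using mom(4) Tpos[OF that] by (simp add: power_divide)
    finally show ?thesis .
  qed
  \<comment> \<open>If the path stays below \<open>c\<close> at all times \<open>T i\<close>, then
    each block in n, ..., 2n - 1 either starts too low (\<open>G i\<close>) or fails to lift (not
    \<open>E i\<close>). Starting at \<open>n\<close> makes the union of the \<open>G i\<close>
    small, and having \<open>n\<close> independent blocks makes failure of all lifts small.\<close>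
  have bound: "prob A \<le> real n * (1 / 4) ^ n + (1 - p) ^ n" if "0 < n" for n
  proof -
    let ?J = "{n..<2*n}"
    have "prob A \<le> prob ((\<Union>i\<in>?J. G i) \<union> (\<Inter>i\<in>?J. space M - E i))"
    proof (rule finite_measure_mono)
      show "A \<subseteq> (\<Union>i\<in>?J. G i) \<union> (\<Inter>i\<in>?J. space M - E i)"
      proof
        fix \<omega> assume A: "\<omega> \<in> A"
        then have sp: "\<omega> \<in> space M" by (simp add: A_def)
        have "\<omega> \<notin> E i" if "\<omega> \<notin> G i" for i
        proof
          assume "\<omega> \<in> E i"
          then have "c \<le> Im (B (T (Suc i)) \<omega>)" using that sp by (auto simp: E_def G_def I_def)
          then show False using A by (auto simp: A_def not_le[symmetric])
        qed
        then show "\<omega> \<in> (\<Union>i\<in>?J. G i) \<union> (\<Inter>i\<in>?J. space M - E i)" using sp by blast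
      qed
      show "(\<Union>i\<in>?J. G i) \<union> (\<Inter>i\<in>?J. space M - E i) \<in> sets M"
        using that by (intro sets.Un sets.finite_UN sets.finite_INT) auto
    qed
    also have "\<dots> \<le> prob (\<Union>i\<in>?J. G i) + prob (\<Inter>i\<in>?J. space M - E i)"
      using that by (intro measure_Un_le sets.finite_UN sets.finite_INT) auto
    also have "prob (\<Union>i\<in>?J. G i) \<le> (\<Sum>i\<in>?J. prob (G i))"
      by (intro finite_measure_subadditive_finite) auto
    also have "\<dots> \<le> (\<Sum>i\<in>?J. (1 / 4) ^ n)"
    proof (rule sum_mono)
      fix i assume "i \<in> ?J"
      then have "prob (G i) \<le> (1 / 4) ^ i" using that by (intro pG) auto
      also have "(1 / 4 :: real) ^ i \<le> (1 / 4) ^ n" using \<open>i \<in> ?J\<close> by (intro power_decreasing) auto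
      finally show "prob (G i) \<le> (1 / 4) ^ n" .
    qed
    also have "\<dots> = real n * (1 / 4) ^ n" by simp
    also have "prob (\<Inter>i\<in>?J. space M - E i) = (\<Prod>i\<in>?J. prob (space M - E i))"
    proof -
      have iv: "\<forall>m (s :: nat \<Rightarrow> real). 0 \<le> s 0 \<and> (\<forall>i<m. s i \<le> s (Suc i)) \<longrightarrow>
        indep_vars (\<lambda>_. borel) (\<lambda>i \<omega>. B (s (Suc i)) \<omega> - B (s i) \<omega>) {..<m}"
        using bm unfolding planar_brownian_motion_def by blast
      have "indep_vars (\<lambda>_. borel) I {..<2*n}"
        unfolding I_def[abs_def] by (rule iv[rule_format]) (use T0 Tmono less_imp_le in auto)
      then have "prob (\<Inter>i\<in>?J. I i -` {w. Im w < c + K i} \<inter> space M) =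
          (\<Prod>i\<in>?J. prob (I i -` {w. Im w < c + K i} \<inter> space M))"
        by (rule indep_varsD) (use that in auto)
      moreover have "I i -` {w. Im w < c + K i} \<inter> space M = space M - E i" for i
        by (auto simp: E_def)
      ultimately show ?thesis by (simp only:)
    qed
    also have "\<dots> \<le> (\<Prod>i\<in>?J. 1 - p)"
      using pE by (intro prod_mono) (auto simp: prob_compl)
    also have "\<dots> = (1 - p) ^ n" by simp
    finally show ?thesis by simp
  qed
  have "p < 1"
    using pE[of 0] prob_le_1[of "E 0"] by (simp add: p_def field_simps) 
      (smt (verit) exp_less_one_iff pi_gt3 real_sqrt_ge_1_iff)
  have "(\<lambda>n. real n * (1 / 4) ^ n + (1 - p) ^ n) \<longlonglongrightarrow> 0 + 0"
    using p \<open>p < 1\<close> by (intro tendsto_add powser_times_n_limit_0 LIMSEQ_realpow_zero) auto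
  then have "prob A \<le> 0"
    by (intro tendsto_lowerbound[where F = sequentially])
       (use bound in \<open>auto simp: eventually_sequentially intro!: exI[of _ 1]\<close>)
  then have "prob A = 0" using measure_nonneg[of M A] by linarith
  then have "AE \<omega> in M. \<omega> \<notin> A" by (simp add: AE_iff_measurable[of A] A_def emeasure_eq_measure)
  then show ?thesis using AE_space
  proof eventually_elim
    case (elim \<omega>)
    then show ?case using Tnn by (auto simp: A_def not_less)
  qed
qed

section \<open>The inverse Joukowski map and cosine polynomials\<close>

lemma Im_csqrt_nonneg: "0 \<le> Im z \<Longrightarrow> Im (csqrt z) = sqrt ((cmod z - Re z) / 2)"
  by (cases "Im z = 0") auto

text \<open>The principal root jumps across the negative axis, but its value there is the limit from
  above. On the closed upper half-plane both coordinates are given by formulas without a choice of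
  sign.\<close>

lemma continuous_on_csqrt_closed_upper: "continuous_on {z. 0 \<le> Im z} csqrt"
proof -
  have "continuous_on {z. 0 \<le> Im z}
      (\<lambda>z. Complex (sqrt ((cmod z + Re z) / 2)) (sqrt ((cmod z - Re z) / 2)))"
    unfolding Complex_eq by (intro continuous_intros) auto
  then show ?thesis
    by (rule continuous_on_eq) (auto simp: complex_eq_iff Im_csqrt_nonneg)
qed

text \<open>With a = sqrt w and b = sqrt (w - 1) one has (a - b) * (a + b) = 1, so u = - (a - b)^2
  satisfies u + 1/u = 2 - 4 w, an affine variant of the Joukowski equation. Two separate roots,
  instead of one root of w (w - 1), avoid branch choices: w and w - 1 both stay in the closed upper
  half-plane, where \<open>csqrt\<close> is continuous.\<close>

definition half_disc_map :: "complex \<Rightarrow> complex" where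
  "half_disc_map w = - (csqrt w - csqrt (w - 1))\<^sup>2"

lemma continuous_on_half_disc_map: "continuous_on {z. 0 \<le> Im z} half_disc_map"
  unfolding half_disc_map_def
  by (intro continuous_intros continuous_on_csqrt_closed_upper
      continuous_on_compose2[OF continuous_on_csqrt_closed_upper]) auto

lemma holomorphic_on_half_disc_map: "half_disc_map holomorphic_on {z. 0 < Im z}"
  unfolding half_disc_map_def
  by (intro holomorphic_intros) (auto simp: complex_nonpos_Reals_iff)

text \<open>Both roots lie in the closed first quadrant, so the cross term in |a + b|^2 is
  nonnegative and |a|^2 + |b|^2 \<le> |a + b|^2, while |a - b| * |a + b| = 1. The estimate yields
  both the bound by 1 and the decay at infinity.\<close>

lemma norm_half_disc_map_le:
  assumes "0 \<le> Im w"
  shows "cmod (half_disc_map w) * (cmod w + cmod (w - 1)) \<le> 1"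
proof -
  define a b where "a = csqrt w" and "b = csqrt (w - 1)"
  have ab: "0 \<le> Re a" "0 \<le> Re b" "0 \<le> Im a" "0 \<le> Im b"
    using assms Re_csqrt complex_Re_le_cmod[of w] complex_Re_le_cmod[of "w - 1"]
    by (auto simp: a_def b_def Im_csqrt_nonneg simp del: csqrt.sel)
  have sq: "a\<^sup>2 = w" "b\<^sup>2 = w - 1" by (simp_all add: a_def b_def)
  have "cmod w + cmod (w - 1) = (cmod a)\<^sup>2 + (cmod b)\<^sup>2"
    by (simp add: a_def b_def)
  also have "\<dots> \<le> (cmod (a + b))\<^sup>2"
    using mult_nonneg_nonneg[OF ab(1,2)] mult_nonneg_nonneg[OF ab(3,4)]
    by (simp add: cmod_power2 power2_sum)
  finally have le: "cmod w + cmod (w - 1) \<le> (cmod (a + b))\<^sup>2" .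
  have "(a - b) * (a + b) = 1" using sq by (simp add: algebra_simps power2_eq_square)
  then have "cmod (a - b) * cmod (a + b) = 1" by (metis norm_mult norm_one)
  then have "(cmod (a - b))\<^sup>2 * (cmod (a + b))\<^sup>2 = 1" by (metis power_mult_distrib power_one)
  then show ?thesis
    using mult_left_mono[OF le, of "(cmod (a - b))\<^sup>2"]
    by (simp add: half_disc_map_def a_def b_def norm_power)
qed

lemma norm_half_disc_map_le_1:
  assumes "0 \<le> Im w"
  shows "cmod (half_disc_map w) \<le> 1"
proof -
  have "1 \<le> cmod w + cmod (w - 1)" using norm_triangle_ineq4[of w "w - 1"] by simp
  then show ?thesis
    using norm_half_disc_map_le[OF assms] mult_left_mono[of 1 "cmod w + cmod (w - 1)" "cmod (half_disc_map w)"]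
    by simp
qed

text \<open>Half-angle formulas: the two roots are sin (\<theta>/2) and i cos (\<theta>/2), and the
  minus sign in the definition turns the square of their difference into the square of cis
  (\<theta>/2).\<close>

lemma half_disc_map_circle:
  assumes "0 \<le> \<theta>" "\<theta> \<le> pi"
  shows "half_disc_map (of_real ((1 - cos \<theta>) / 2)) = cis \<theta>"
proof -
  have s: "0 \<le> sin (\<theta> / 2)" "0 \<le> cos (\<theta> / 2)"
    using assms by (auto intro!: sin_ge_zero cos_ge_zero)
  have x: "(1 - cos \<theta>) / 2 = (sin (\<theta> / 2))\<^sup>2" "(1 - cos \<theta>) / 2 - 1 = - ((cos (\<theta> / 2))\<^sup>2)"
    using cos_double_sin[of "\<theta>/2"] cos_double_cos[of "\<theta>/2"] by simp_all
  have "csqrt (of_real ((1 - cos \<theta>) / 2)) = of_real (sin (\<theta> / 2))"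
    unfolding x using s by simp
  moreover have "csqrt (of_real ((1 - cos \<theta>) / 2) - 1) = \<i> * of_real (cos (\<theta> / 2))"
  proof -
    have "csqrt (of_real ((1 - cos \<theta>) / 2 - 1)) = \<i> * of_real (cos (\<theta> / 2))"
      unfolding x(2) using s by (intro csqrt_unique) (auto simp: power_mult_distrib)
    then show ?thesis by simp
  qed
  ultimately have "half_disc_map (of_real ((1 - cos \<theta>) / 2)) =
      (cis (\<theta> / 2))\<^sup>2"
    by (simp add: half_disc_map_def complex_eq_iff power2_eq_square)
  then show ?thesis by (simp add: Complex.DeMoivre)
qed

text \<open>Outside [0,1] the numbers x and x - 1 have the same sign, so the two roots are both real
  or both imaginary. These are the points that correspond to the vertical sides.\<close>

lemma half_disc_map_real:
  assumes "x \<notin> {0..1}"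
  shows "half_disc_map (of_real x) \<in> \<real>"
proof (cases "x < 0")
  case True
  have ii: "- (\<i> * of_real a - \<i> * of_real b)\<^sup>2 = complex_of_real ((a - b)\<^sup>2)" for a b
    by (simp add: power2_eq_square algebra_simps)
  from True have "csqrt (of_real x) = \<i> * of_real (sqrt \<bar>x\<bar>)" "csqrt (of_real (x - 1)) = \<i> * of_real (sqrt \<bar>x - 1\<bar>)"
    by simp_all
  then have "half_disc_map (of_real x) = of_real ((sqrt \<bar>x\<bar> - sqrt \<bar>x - 1\<bar>)\<^sup>2)"
    using ii[of "sqrt \<bar>x\<bar>" "sqrt \<bar>x - 1\<bar>"] by (simp add: half_disc_map_def)
  then show ?thesis by (metis Reals_of_real)
next
  case False
  then have "csqrt (of_real x) = of_real (sqrt x)" "csqrt (of_real (x - 1)) = of_real (sqrt (x - 1))"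
    using assms by simp_all
  then have "half_disc_map (of_real x) = of_real (- (sqrt x - sqrt (x - 1))\<^sup>2)"
    by (simp add: half_disc_map_def)
  then show ?thesis by (metis Reals_of_real)
qed

text \<open>Only the values of \<open>F\<close> on [0,1] are constrained. For real coefficients, Re
  (q (cis \<theta>)) is a linear combination of the cos (k \<theta>), and \<open>q\<close> is real
  on the real line, which later makes \<open>h\<close> real on the sides.\<close>

definition cosine_polynomial :: "(real \<Rightarrow> real) \<Rightarrow> bool" where
  "cosine_polynomial F \<longleftrightarrow> (\<exists>q :: complex poly. (\<forall>i. coeff q i \<in> \<real>) \<and>
     (\<forall>\<theta>. F ((1 - cos \<theta>) / 2) = Re (poly q (cis \<theta>))))"

lemma cosine_polynomial_const: "cosine_polynomial (\<lambda>_. c)"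
  unfolding cosine_polynomial_def
  by (rule exI[of _ "[:of_real c:]"]) (auto simp: coeff_pCons split: nat.split)

lemma cosine_polynomial_add:
  assumes "cosine_polynomial F" "cosine_polynomial G"
  shows "cosine_polynomial (\<lambda>x. F x + G x)"
proof -
  obtain q r where "\<forall>i. coeff q i \<in> \<real>" "\<forall>\<theta>. F ((1 - cos \<theta>) / 2) = Re (poly q (cis \<theta>))"
    "\<forall>i. coeff r i \<in> \<real>" "\<forall>\<theta>. G ((1 - cos \<theta>) / 2) = Re (poly r (cis \<theta>))"
    using assms unfolding cosine_polynomial_def by auto
  then show ?thesis
    unfolding cosine_polynomial_def by (intro exI[of _ "q + r"]) auto
qed

lemma cosine_polynomial_cmult:
  assumes "cosine_polynomial F"
  shows "cosine_polynomial (\<lambda>x. c * F x)"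
proof -
  obtain q where "\<forall>i. coeff q i \<in> \<real>" "\<forall>\<theta>. F ((1 - cos \<theta>) / 2) = Re (poly q (cis \<theta>))"
    using assms unfolding cosine_polynomial_def by auto
  then show ?thesis
    unfolding cosine_polynomial_def by (intro exI[of _ "smult (of_real c) q"]) auto
qed

text \<open>On the unit circle \<open>cnj u = 1 / u\<close>, so \<open>2 * Re u * Re (q u)\<close> is the real part of a polynomial.\<close>

lemma cosine_polynomial_mult_x:
  assumes "cosine_polynomial F"
  shows "cosine_polynomial (\<lambda>x. x * F x)"
proof -
  obtain q where q: "\<forall>i. coeff q i \<in> \<real>" "\<forall>\<theta>. F ((1 - cos \<theta>) / 2) = Re (poly q (cis \<theta>))"
    using assms unfolding cosine_polynomial_def by auto
  obtain c r where qc: "q = pCons c r" by (cases q)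
  have c: "c \<in> \<real>" using q(1)[rule_format, of 0] by (simp add: qc)
  have r: "coeff r i \<in> \<real>" for i using q(1)[rule_format, of "Suc i"] by (simp add: qc)
  have "cosine_polynomial (\<lambda>x. (1 - 2 * x) * F x)"
    unfolding cosine_polynomial_def
  \<comment> \<open>With q(u) = c + u r(u), the product cnj u * q(u) is c * cnj u + r(u), and c *
    cnj u has the same real part as c * u because c is real. The witness is half the sum of u * q(u)
    and this replacement.\<close>
  proof (intro exI[of _ "smult (1/2) (pCons 0 q + [:0, c:] + r)"] conjI allI)
    fix i show "coeff (smult (1/2) (pCons 0 q + [:0, c:] + r)) i \<in> \<real>"
      using q(1) c r by (auto simp: coeff_pCons split: nat.split intro!: Reals_add Reals_divide)
  next
    fix \<theta>
    define u where "u = cis \<theta>"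
    have u1: "cnj u * u = 1" by (simp add: u_def cis_cnj cis_mult)
    have "2 * cos \<theta> * Re (poly q u) = Re ((u + cnj u) * poly q u)"
      by (simp add: u_def algebra_simps)
    also have "(u + cnj u) * poly q u = u * poly q u + c * cnj u + poly r u"
      using u1 by (simp add: qc algebra_simps)
    also have "Re (u * poly q u + c * cnj u + poly r u) = Re (u * poly q u + c * u + poly r u)"
      using c by (auto simp: complex_is_Real_iff)
    also have "u * poly q u + c * u + poly r u = 2 * poly (smult (1/2) (pCons 0 q + [:0, c:] + r)) u"
      by (simp add: algebra_simps)
    finally have "cos \<theta> * Re (poly q u) = Re (poly (smult (1/2) (pCons 0 q + [:0, c:] + r)) u)"
      by simp
    moreover have "1 - 2 * ((1 - cos \<theta>) / 2) = cos \<theta>" by (simp add: field_simps)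
    ultimately show "(1 - 2 * ((1 - cos \<theta>) / 2)) * F ((1 - cos \<theta>) / 2) =
        Re (poly (smult (1/2) (pCons 0 q + [:0, c:] + r)) (cis \<theta>))"
      using q(2) by (simp only: u_def)
  qed
  \<comment> \<open>Multiplication by x is recovered from x = 1/2 - (1 - 2 x) / 2.\<close>
  from cosine_polynomial_add[OF cosine_polynomial_cmult[OF assms, of "1/2"] cosine_polynomial_cmult[OF this, of "- 1/2"]]
  show ?thesis by (simp add: algebra_simps)
qed

lemma cosine_polynomial_sum:
  "(\<And>k. k \<in> A \<Longrightarrow> cosine_polynomial (F k)) \<Longrightarrow> cosine_polynomial (\<lambda>x. \<Sum>k\<in>A. F k x)"
  by (induction A rule: infinite_finite_induct)
     (auto intro: cosine_polynomial_const cosine_polynomial_add)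

lemma cosine_polynomial_Bernstein: "cosine_polynomial (\<lambda>x. Bernstein n k x)"
proof -
  have 1: "cosine_polynomial (\<lambda>x. x ^ k * (c * F x))" if "cosine_polynomial F" for F k c
  proof (induction k)
    case 0 then show ?case using cosine_polynomial_cmult[OF that] by simp
  next
    case (Suc k) then show ?case using cosine_polynomial_mult_x[OF Suc] by (simp add: mult.assoc)
  qed
  have 2: "cosine_polynomial (\<lambda>x. (1 - x) ^ m)" for m
  proof (induction m)
    case 0 then show ?case using cosine_polynomial_const by simp
  next
    case (Suc m)
    from cosine_polynomial_add[OF this cosine_polynomial_cmult[OF cosine_polynomial_mult_x[OF this], of "-1"]]
    show ?case by (simp add: algebra_simps)
  qed
  from 1[OF 2, of k "of_nat (n choose k)" "n - k"] show ?thesis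
    by (simp add: Bernstein_def mult.assoc mult.left_commute)
qed

lemma cosine_polynomial_approximation:
  fixes f :: "real \<Rightarrow> real"
  assumes "continuous_on {0..1} f" "0 < e"
  obtains q :: "complex poly" where "\<And>i. coeff q i \<in> \<real>"
    "\<And>\<theta>. \<bar>f ((1 - cos \<theta>) / 2) - Re (poly q (cis \<theta>))\<bar> < e"
proof -
  obtain n where n: "\<And>x. x \<in> {0..1} \<Longrightarrow> \<bar>f x - (\<Sum>k\<le>n. f (k / n) * Bernstein n k x)\<bar> < e"
    using Bernstein_Weierstrass[OF assms] by blast
  have "cosine_polynomial (\<lambda>x. \<Sum>k\<le>n. f (k / n) * Bernstein n k x)"
    by (intro cosine_polynomial_sum cosine_polynomial_cmult cosine_polynomial_Bernstein)
  then obtain q :: "complex poly" where q: "\<forall>i. coeff q i \<in> \<real>"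
    "\<forall>\<theta>. (\<Sum>k\<le>n. f (k / n) * Bernstein n k ((1 - cos \<theta>) / 2)) = Re (poly q (cis \<theta>))"
    unfolding cosine_polynomial_def by blast
  show thesis
  proof (rule that[of q])
    fix \<theta>
    show "\<bar>f ((1 - cos \<theta>) / 2) - Re (poly q (cis \<theta>))\<bar> < e"
      using n[of "(1 - cos \<theta>) / 2"] unfolding q(2)[rule_format] by simp
  qed (use q in simp)
qed

text \<open>The mean value property over a half-circle. It relies on the real coefficients: they
  remove the terms sin (k \<theta>), whose integral over [0, pi] is nonzero for odd k, while each
  cos (k \<theta>) with k \<ge> 1 integrates to 0.\<close>

lemma integral_poly_cis:
  fixes q :: "complex poly"
  assumes q: "\<And>i. coeff q i \<in> \<real>"
  shows "((\<lambda>\<theta>. Re (poly q (cis \<theta>))) has_integral pi * Re (coeff q 0)) {0..pi}"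
proof -
  have re: "Re (poly q (cis \<theta>)) = (\<Sum>k\<le>degree q. Re (coeff q k) * cos (real k * \<theta>))" for \<theta>
  proof -
    have "Im (coeff q k) = 0" for k using q[of k] by (simp add: complex_is_Real_iff)
    then show ?thesis by (simp add: poly_altdef Complex.DeMoivre)
  qed
  have "((\<lambda>\<theta>. Re (coeff q k) * cos (real k * \<theta>)) has_integral
      Re (coeff q k) * (if k = 0 then pi else 0)) {0..pi}" for k
  proof (rule has_integral_mult_right, cases "k = 0")
    case True
    then show "((\<lambda>\<theta>. cos (real k * \<theta>)) has_integral (if k = 0 then pi else 0)) {0..pi}"
      using has_integral_const_real[of "1::real" 0 pi] by simp
  next
    case False
    have "((\<lambda>\<theta>. cos (real k * \<theta>)) has_integral (sin (real k * pi) / real k - sin (real k * 0) / real k)) {0..pi}"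
      by (rule fundamental_theorem_of_calculus)
         (use False in \<open>auto intro!: derivative_eq_intros simp flip: has_real_derivative_iff_has_vector_derivative\<close>)
    then show "((\<lambda>\<theta>. cos (real k * \<theta>)) has_integral (if k = 0 then pi else 0)) {0..pi}"
      using False by simp
  qed
  then have "((\<lambda>\<theta>. \<Sum>k\<le>degree q. Re (coeff q k) * cos (real k * \<theta>)) has_integral
      (\<Sum>k\<le>degree q. Re (coeff q k) * (if k = 0 then pi else 0))) {0..pi}"
    by (intro has_integral_sum) auto
  moreover have "(\<Sum>k\<le>degree q. Re (coeff q k) * (if k = 0 then pi else 0)) = pi * Re (coeff q 0)"
    by (simp add: if_distrib[of "\<lambda>x. _ * x"] cong: if_cong)
  ultimately show ?thesis by (simp add: re)
qed

section \<open>Reflection in the strip\<close>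

lemma strip_reflection_sel:
  "Re (strip_reflection w) = arccos (cos (pi * Re w)) / pi" "Im (strip_reflection w) = Im w"
  by (simp_all add: strip_reflection_def)

lemma Re_strip_reflection_bounds: "0 \<le> Re (strip_reflection w)" "Re (strip_reflection w) \<le> 1"
  using arccos_bounded[of "cos (pi * Re w)"] by (auto simp: strip_reflection_sel)

lemma continuous_on_strip_reflection: "continuous_on A strip_reflection"
  unfolding strip_reflection_def Complex_eq
  by (intro continuous_intros continuous_on_arccos) auto

lemma strip_reflection_id:
  assumes "0 \<le> Re w" "Re w \<le> 1"
  shows "strip_reflection w = w"
proof -
  have "arccos (cos (pi * Re w)) = pi * Re w" using assms by (intro arccos_cos) auto
  then show ?thesis by (simp add: complex_eq_iff strip_reflection_sel)
qed

lemma strip_reflection_cong: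
  assumes "cos (pi * Re w) = cos (pi * Re v)" "Im w = Im v"
  shows "strip_reflection w = strip_reflection v"
  using assms by (simp add: strip_reflection_def)

lemma strip_reflection_even:
  assumes "2 * of_int m \<le> Re w" "Re w \<le> 2 * of_int m + 1"
  shows "strip_reflection w = w - 2 * of_int m"
proof -
  have "strip_reflection w = strip_reflection (w - 2 * of_int m)"
  proof (rule strip_reflection_cong)
    have "pi * Re (w - 2 * of_int m) = pi * Re w - of_int m * (2 * pi)" by (simp add: algebra_simps)
    then show "cos (pi * Re w) = cos (pi * Re (w - 2 * of_int m))"
      using cos.minus_of_int[of "pi * Re w" m] by (simp add: cos_diff sin_int_times_real cos_int_times_real)
  qed simp
  also have "\<dots> = w - 2 * of_int m" using assms by (intro strip_reflection_id) auto
  finally show ?thesis .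
qed

lemma strip_reflection_odd:
  assumes "2 * of_int m - 1 \<le> Re w" "Re w \<le> 2 * of_int m"
  shows "strip_reflection w = 2 * of_int m - cnj w"
proof -
  have "strip_reflection w = strip_reflection (2 * of_int m - cnj w)"
  proof (rule strip_reflection_cong)
    have "pi * Re (2 * of_int m - cnj w) = of_int m * (2 * pi) - pi * Re w" by (simp add: algebra_simps)
    then show "cos (pi * Re w) = cos (pi * Re (2 * of_int m - cnj w))"
      using cos.minus_of_int[of "pi * Re w" m] cos_minus[of "pi * Re w - of_int m * (2 * pi)"]
      by (simp only: minus_diff_eq of_real_eq_id id_apply)
  qed simp
  also have "\<dots> = 2 * of_int m - cnj w" using assms by (intro strip_reflection_id) auto
  finally show ?thesis .
qed

text \<open>More than the preimage of \<open>domain_below\<close>: the region includes the parts of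
  the lines Re w = k, k an integer, that lie below the curve, and so crosses the sides.\<close>

definition periodic_domain_below :: "(real \<Rightarrow> real) \<Rightarrow> complex set" where
  "periodic_domain_below \<gamma> = {w. Im w < \<gamma> (Re (strip_reflection w))}"

lemma continuous_on_strip_reflection_graph:
  assumes "continuous_on {0..1} \<gamma>"
  shows "continuous_on A (\<lambda>w. \<gamma> (Re (strip_reflection w)))"
  by (rule continuous_on_compose2[OF assms])
     (auto intro!: continuous_intros continuous_on_strip_reflection simp: Re_strip_reflection_bounds)

lemma open_periodic_domain_below:
  assumes "continuous_on {0..1} \<gamma>"
  shows "open (periodic_domain_below \<gamma>)"
  unfolding periodic_domain_below_def
  by (intro open_Collect_less continuous_intros continuous_on_strip_reflection_graph assms)

lemma closure_domain_below:
  assumes \<gamma>: "continuous_on {0..1} \<gamma>"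
  shows "closure (domain_below \<gamma>) = {w. 0 \<le> Re w \<and> Re w \<le> 1 \<and> Im w \<le> \<gamma> (Re w)}" (is "_ = ?K")
proof
  have "closed {w. 0 \<le> Re w \<and> Re w \<le> 1 \<and> Im w \<le> \<gamma> (Re (strip_reflection w))}"
    by (intro closed_Collect_conj closed_Collect_le continuous_intros
        continuous_on_strip_reflection_graph \<gamma>)
  also have "{w. 0 \<le> Re w \<and> Re w \<le> 1 \<and> Im w \<le> \<gamma> (Re (strip_reflection w))} = ?K"
    using strip_reflection_id by auto
  finally show "closure (domain_below \<gamma>) \<subseteq> ?K"
    by (intro closure_minimal) (auto simp: domain_below_def)
  show "?K \<subseteq> closure (domain_below \<gamma>)"
  proof
    fix w assume w: "w \<in> ?K"
    define d where "d n = inverse (real (Suc n))" for n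
    have d: "d \<longlonglongrightarrow> 0" unfolding d_def by (rule LIMSEQ_inverse_real_of_nat)
    define x where "x n = Re w + d n * (1/2 - Re w)" for n
    have x_lim: "x \<longlonglongrightarrow> Re w"
      unfolding x_def using tendsto_add[OF tendsto_const tendsto_mult[OF d tendsto_const]] by simp
    have dn: "0 < d n" "d n \<le> 1" for n by (auto simp: d_def inverse_le_1_iff)
    have xn: "0 < x n" "x n < 1" for n
    proof -
      have "x n = (1 - d n) * Re w + d n * (1/2)" by (simp add: x_def algebra_simps)
      moreover have "0 \<le> (1 - d n) * Re w" "(1 - d n) * Re w \<le> 1 - d n"
        using w dn[of n] by (auto intro: mult_left_le)
      ultimately show "0 < x n" "x n < 1" using dn[of n] by linarith+
    qed
    \<comment> \<open>The abscissa is drawn towards 1/2 to enter the open strip. Correcting the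
      height by the change of \<gamma> keeps the depth below the curve, and subtracting
      \<open>d n\<close> makes it strict.\<close>
    define v where "v n = Complex (x n) (Im w - \<gamma> (Re w) + \<gamma> (x n) - d n)" for n
    have "v n \<in> domain_below \<gamma>" for n
      using xn[of n] dn[of n] w by (auto simp: v_def domain_below_def)
    moreover have "v \<longlonglongrightarrow> w"
    proof -
      have "(\<lambda>n. \<gamma> (x n)) \<longlonglongrightarrow> \<gamma> (Re w)"
        by (rule continuous_on_tendsto_compose[OF \<gamma> x_lim])
           (use w xn less_imp_le in \<open>auto intro!: always_eventually\<close>)
      then have "(\<lambda>n. Im w - \<gamma> (Re w) + \<gamma> (x n) - d n) \<longlonglongrightarrow> Im w - \<gamma> (Re w) + \<gamma> (Re w) - 0"
        by (intro tendsto_intros d)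
      from tendsto_Complex[OF x_lim this] show ?thesis unfolding v_def by simp
    qed
    ultimately show "w \<in> closure (domain_below \<gamma>)" unfolding closure_sequential by blast
  qed
qed

text \<open>On strips starting at an even integer the folding is a translation; on the others it is
  an antiholomorphic reflection, and the outer conjugation restores holomorphy. On the dividing
  lines the two cases agree inside the periodic domain, where \<open>h\<close> is real.\<close>

definition strip_extension :: "(complex \<Rightarrow> complex) \<Rightarrow> complex \<Rightarrow> complex" where
  "strip_extension h w =
     (if even \<lfloor>Re w\<rfloor> then h (strip_reflection w) else cnj (h (strip_reflection w)))"

lemma Re_strip_extension [simp]: "Re (strip_extension h w) = Re (h (strip_reflection w))"
  and norm_strip_extension [simp]: "cmod (strip_extension h w) = cmod (h (strip_reflection w))"
  by (simp_all add: strip_extension_def)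

section \<open>Schwarz reflection across all vertical sides\<close>

context
  fixes \<gamma> :: "real \<Rightarrow> real" and h :: "complex \<Rightarrow> complex"
  assumes \<gamma>: "continuous_on {0..1} \<gamma>"
    and h_cont: "continuous_on (closure (domain_below \<gamma>)) h"
    and h_hol: "h holomorphic_on domain_below \<gamma>"
    and h_real: "\<And>w. Re w \<in> {0, 1} \<Longrightarrow> Im w < \<gamma> (Re w) \<Longrightarrow> h w \<in> \<real>"
begin

private abbreviation "V \<equiv> periodic_domain_below \<gamma>"

lemma strip_extension_even:
  assumes "w \<in> V" "2 * of_int m \<le> Re w" "Re w \<le> 2 * of_int m + 1"
  shows "strip_extension h w = h (w - 2 * of_int m)"
proof (cases "Re w < 2 * of_int m + 1")
  case True
  then have "\<lfloor>Re w\<rfloor> = 2 * m" using assms by (intro floor_unique) auto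
  then show ?thesis using strip_reflection_even[OF assms(2,3)] by (simp add: strip_extension_def)
next
  \<comment> \<open>On the right edge the floor is odd and the definition conjugates;
    \<open>h\<close> is real there, so the formula extends to the closed strip.\<close>
  case False
  then have "Re (w - 2 * of_int m) = 1" using assms by simp
  moreover have "Im w < \<gamma> (Re (w - 2 * of_int m))"
    using assms(1) strip_reflection_even[OF assms(2,3)] by (simp add: periodic_domain_below_def)
  ultimately have "h (w - 2 * of_int m) \<in> \<real>" by (intro h_real) auto
  then show ?thesis
    using strip_reflection_even[OF assms(2,3)] by (auto simp: strip_extension_def Reals_cnj_iff)
qed

lemma strip_extension_odd:
  assumes "w \<in> V" "2 * of_int m - 1 \<le> Re w" "Re w \<le> 2 * of_int m"
  shows "strip_extension h w = cnj (h (2 * of_int m - cnj w))"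
proof (cases "Re w < 2 * of_int m")
  case True
  then have "\<lfloor>Re w\<rfloor> = 2 * m - 1" using assms by (intro floor_unique) auto
  then show ?thesis using strip_reflection_odd[OF assms(2,3)] by (simp add: strip_extension_def)
next
  case False
  then have "Re (2 * of_int m - cnj w) = 0" using assms by simp
  moreover have "Im w < \<gamma> (Re (2 * of_int m - cnj w))"
    using assms(1) strip_reflection_odd[OF assms(2,3)] by (simp add: periodic_domain_below_def)
  ultimately have "h (2 * of_int m - cnj w) \<in> \<real>" by (intro h_real) auto
  then show ?thesis
    using strip_reflection_odd[OF assms(2,3)] by (auto simp: strip_extension_def Reals_cnj_iff)
qed

lemma strip_extension_on_strips:
  fixes k :: int
  shows "continuous_on (V \<inter> {w. of_int k \<le> Re w \<and> Re w \<le> of_int k + 1}) (strip_extension h)"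
    and "strip_extension h holomorphic_on (V \<inter> {w. of_int k < Re w \<and> Re w < of_int k + 1})"
proof -
  let ?C = "V \<inter> {w. of_int k \<le> Re w \<and> Re w \<le> of_int k + 1}"
  let ?O = "V \<inter> {w. of_int k < Re w \<and> Re w < of_int k + 1}"
  have oO: "open ?O"
    by (intro open_Int open_periodic_domain_below \<gamma> open_Collect_conj open_Collect_less continuous_intros)
  have "continuous_on ?C (strip_extension h) \<and> strip_extension h holomorphic_on ?O"
  proof (cases "even k")
    case True
    then obtain m where k: "k = 2 * m" by (auto elim: evenE)
    have sub: "w - 2 * of_int m \<in> closure (domain_below \<gamma>)" if "w \<in> ?C" for w
      using that strip_reflection_even[of m w]
      by (auto simp: closure_domain_below[OF \<gamma>] periodic_domain_below_def k)
    have sub': "w - 2 * of_int m \<in> domain_below \<gamma>" if "w \<in> ?O" for w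
      using that strip_reflection_even[of m w]
      by (auto simp: domain_below_def periodic_domain_below_def k)
    have "continuous_on ?C (\<lambda>w. h (w - 2 * of_int m))"
      by (rule continuous_on_compose2[OF h_cont]) (use sub in \<open>auto intro!: continuous_intros\<close>)
    then have "continuous_on ?C (strip_extension h)"
      by (rule continuous_on_eq) (auto simp: k strip_extension_even[of _ m])
    moreover have "(\<lambda>w. h (w - 2 * of_int m)) holomorphic_on ?O"
      by (rule holomorphic_on_compose_gen[OF _ h_hol, unfolded o_def])
         (use sub' in \<open>auto intro!: holomorphic_intros\<close>)
    then have "strip_extension h holomorphic_on ?O"
      by (rule holomorphic_transform) (auto simp: k strip_extension_even[of _ m])
    ultimately show ?thesis by blast
  next
    case False
    then have "even (k + 1)" by simp
    then obtain m where "k + 1 = 2 * m" by (rule evenE)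
    then have k: "k = 2 * m - 1" by simp
    have sub: "2 * of_int m - cnj w \<in> closure (domain_below \<gamma>)" if "w \<in> ?C" for w
      using that strip_reflection_odd[of m w]
      by (auto simp: closure_domain_below[OF \<gamma>] periodic_domain_below_def k)
    have sub': "2 * of_int m - cnj w \<in> domain_below \<gamma>" if "w \<in> ?O" for w
      using that strip_reflection_odd[of m w]
      by (auto simp: domain_below_def periodic_domain_below_def k)
    have "continuous_on ?C (\<lambda>w. cnj (h (2 * of_int m - cnj w)))"
      by (intro continuous_intros continuous_on_compose2[OF h_cont]) (use sub in auto)
    then have "continuous_on ?C (strip_extension h)"
      by (rule continuous_on_eq) (auto simp: k strip_extension_odd[of _ m])
    moreover have "(\<lambda>w. cnj (h (2 * of_int m - cnj w))) holomorphic_on ?O"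
    proof -
      \<comment> \<open>The reflected function is a holomorphic map placed between two
        conjugations.\<close>
      have "(\<lambda>u. h (2 * of_int m - u)) holomorphic_on cnj ` ?O"
        by (rule holomorphic_on_compose_gen[OF _ h_hol, unfolded o_def])
           (use sub' in \<open>auto intro!: holomorphic_intros\<close>)
      then have "(cnj \<circ> (\<lambda>u. h (2 * of_int m - u)) \<circ> cnj) holomorphic_on ?O"
        using oO by (subst holomorphic_on_compose_cnj_cnj) auto
      then show ?thesis by (simp add: o_def)
    qed
    then have "strip_extension h holomorphic_on ?O"
      by (rule holomorphic_transform) (auto simp: k strip_extension_odd[of _ m])
    ultimately show ?thesis by blast
  qed
  then show "continuous_on ?C (strip_extension h)" "strip_extension h holomorphic_on ?O" by auto
qed

text \<open>Strips of width 2 centred at the integers cover the plane, and each contains exactly one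
  dividing line. Continuity across that line and holomorphy on either side give holomorphy on the
  strip.\<close>

lemma strip_extension_holomorphic: "strip_extension h holomorphic_on V"
proof -
  define S where "S k = V \<inter> {w. of_int k - 1 < Re w \<and> Re w < of_int k + 1}" for k :: int
  have oS: "open (S k)" for k
    unfolding S_def
    by (intro open_Int open_periodic_domain_below \<gamma> open_Collect_conj open_Collect_less continuous_intros)
  have "strip_extension h holomorphic_on S k" for k
  proof (rule holomorphic_on_paste_across_line[OF oS, where d = 1 and k = "of_int k"])
    show "strip_extension h holomorphic_on S k \<inter> {z. 1 \<bullet> z < of_int k}"
      by (rule holomorphic_on_subset[OF strip_extension_on_strips(2)[of "k - 1"]])
         (auto simp: S_def inner_complex_def)
    show "strip_extension h holomorphic_on S k \<inter> {z. of_int k < 1 \<bullet> z}"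
      by (rule holomorphic_on_subset[OF strip_extension_on_strips(2)[of k]])
         (auto simp: S_def inner_complex_def)
    let ?L = "S k \<inter> {z. Re z \<le> of_int k}" and ?R = "S k \<inter> {z. of_int k \<le> Re z}"
    have "closed {z. Re z \<le> of_int k}" "closed {z. of_int k \<le> Re z}"
      by (intro closed_Collect_le continuous_intros)+
    moreover have eq: "?L \<union> ?R = S k" by auto
    ultimately have "closedin (top_of_set (?L \<union> ?R)) ?L" "closedin (top_of_set (?L \<union> ?R)) ?R"
      by (auto intro: closedin_closed_Int)
    moreover have "continuous_on ?L (strip_extension h)"
      by (rule continuous_on_subset[OF strip_extension_on_strips(1)[of "k - 1"]]) (auto simp: S_def)
    moreover have "continuous_on ?R (strip_extension h)"
      by (rule continuous_on_subset[OF strip_extension_on_strips(1)[of k]]) (auto simp: S_def)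
    ultimately have "continuous_on (?L \<union> ?R) (strip_extension h)" by (rule continuous_on_Un_local)
    then show "continuous_on (S k) (strip_extension h)" unfolding eq .
  qed simp
  then have "strip_extension h holomorphic_on (\<Union>k. S k)"
    using oS by (intro holomorphic_on_UN_open) auto
  moreover have "V \<subseteq> (\<Union>k. S k)"
  proof
    fix w assume "w \<in> V"
    then have "w \<in> S \<lfloor>Re w\<rfloor>" unfolding S_def by (simp; linarith)
    then show "w \<in> (\<Union>k. S k)" by blast
  qed
  ultimately show ?thesis by (rule holomorphic_on_subset)
qed

end

section \<open>The conformal map and the arcsine law\<close>

lemma continuous_map_Some_iff:
  assumes "f \<in> topspace X \<rightarrow> topspace Y"
  shows "continuous_map X (Alexandroff_compactification Y) (\<lambda>x. Some (f x)) \<longleftrightarrow> continuous_map X Y f"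
proof
  assume L: "continuous_map X (Alexandroff_compactification Y) (\<lambda>x. Some (f x))"
  show "continuous_map X Y f"
    unfolding continuous_map
  proof (intro conjI allI impI)
    fix S assume "openin Y S"
    then have "openin (Alexandroff_compactification Y) (Some ` S)"
      using open_map_Some[of Y] unfolding open_map_def by blast
    then have "openin X {x \<in> topspace X. Some (f x) \<in> Some ` S}"
      using L by (rule openin_continuous_map_preimage[rotated])
    then show "openin X {x \<in> topspace X. f x \<in> S}" by (simp add: image_iff)
  qed (use assms in auto)
next
  assume "continuous_map X Y f"
  from continuous_map_compose[OF this continuous_map_Some]
  show "continuous_map X (Alexandroff_compactification Y) (\<lambda>x. Some (f x))" by (simp add: o_def)
qed

lemma Some_in_closure_of_iff:
  "Some z \<in> riemann_sphere closure_of (Some ` U) \<longleftrightarrow> z \<in> closure U"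
proof
  assume L: "Some z \<in> riemann_sphere closure_of (Some ` U)"
  show "z \<in> closure U"
    unfolding closure_iff_nhds_not_empty
  proof (intro allI impI)
    fix A S assume S: "S \<subseteq> A" "open S" "z \<in> S"
    then have "openin riemann_sphere (Some ` S)"
      using open_map_Some[of euclidean] unfolding open_map_def by simp
    then obtain y where "y \<in> Some ` U" "y \<in> Some ` S"
      using L S(3) unfolding in_closure_of by blast
    then show "U \<inter> A \<noteq> {}" using S(1) by auto
  qed
next
  assume z: "z \<in> closure U"
  show "Some z \<in> riemann_sphere closure_of (Some ` U)"
    unfolding in_closure_of
  proof (intro conjI allI impI)
    fix T :: "complex option set" assume T: "Some z \<in> T \<and> openin riemann_sphere T"
    have "openin euclidean {w \<in> topspace euclidean. Some w \<in> T}"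
      using T by (intro openin_continuous_map_preimage[OF continuous_map_Some]) auto
    then have "open {w. Some w \<in> T}" by simp
    then have "U \<inter> {w. Some w \<in> T} \<noteq> {}"
      using z T unfolding closure_iff_nhds_not_empty by blast
    then show "\<exists>y. y \<in> Some ` U \<and> y \<in> T" by blast
  qed auto
qed

text \<open>Trades the homeomorphism of the sphere for a planar inverse \<open>\<psi>\<close>,
  continuous on the closure of \<open>U\<close> and holomorphic inside, so that the rest of the
  argument stays in the plane.\<close>

lemma normalized_conformal_mapE:
  assumes \<phi>: "normalized_conformal_map U \<Gamma> \<phi>"
  obtains \<psi> where
    "continuous_on {z. 0 \<le> Im z} \<phi>"
    "\<And>x. 0 \<le> Im x \<Longrightarrow> \<psi> (\<phi> x) = x"
    "continuous_on (closure U) \<psi>"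
    "\<And>z. z \<in> closure U \<Longrightarrow> 0 \<le> Im (\<psi> z) \<and> \<phi> (\<psi> z) = z"
    "\<psi> holomorphic_on U" "\<And>z. z \<in> U \<Longrightarrow> 0 < Im (\<psi> z)"
proof -
  let ?H = "{z. 0 \<le> Im z}"
  have H: "Some ` upper_half_plane \<union> Some ` range complex_of_real \<union> {None} = Some ` ?H \<union> {None}"
  proof -
    have "?H \<subseteq> upper_half_plane \<union> range complex_of_real"
      by (auto simp: complex_is_Real_iff[unfolded Reals_def] le_less)
    moreover have "upper_half_plane \<union> range complex_of_real \<subseteq> ?H" by auto
    ultimately show ?thesis by blast
  qed
  define X where "X = subtopology riemann_sphere (Some ` ?H \<union> {None})"
  define Y where "Y = subtopology riemann_sphere (riemann_sphere closure_of (Some ` U))"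
  have "homeomorphic_map X Y (map_option \<phi>)"
    using \<phi> unfolding normalized_conformal_map_def H X_def Y_def by blast
  then obtain g where hm: "homeomorphic_maps X Y (map_option \<phi>) g"
    using homeomorphic_map_maps by blast
  then have c1: "continuous_map X Y (map_option \<phi>)" and c2: "continuous_map Y X g"
    and inv1: "\<And>x. x \<in> topspace X \<Longrightarrow> g (map_option \<phi> x) = x"
    and inv2: "\<And>y. y \<in> topspace Y \<Longrightarrow> map_option \<phi> (g y) = y"
    unfolding homeomorphic_maps_def by auto
  have tX: "topspace X = Some ` ?H \<union> {None}" by (auto simp: X_def)
  have tY: "topspace Y = riemann_sphere closure_of (Some ` U)"
    unfolding Y_def topspace_subtopology by (rule Int_absorb1[OF closure_of_subset_topspace])
  have \<phi>cl: "\<phi> x \<in> closure U" if "0 \<le> Im x" for x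
  proof -
    have "map_option \<phi> (Some x) \<in> topspace Y"
      using continuous_map_funspace[OF c1] that tX by blast
    then show ?thesis by (simp add: tY Some_in_closure_of_iff)
  qed
  \<comment> \<open>\<open>map_option \<phi>\<close> fixes \<open>None\<close>, so the inverse
    cannot send a finite point to infinity.\<close>
  have ex: "\<exists>x. g (Some z) = Some x \<and> 0 \<le> Im x \<and> \<phi> x = z" if "z \<in> closure U" for z
  proof -
    have t: "Some z \<in> topspace Y" using that by (simp add: tY Some_in_closure_of_iff)
    then have "g (Some z) \<in> Some ` ?H \<union> {None}"
      using continuous_map_funspace[OF c2] unfolding tX by blast
    moreover have "map_option \<phi> (g (Some z)) = Some z" using inv2[OF t] .
    ultimately show ?thesis by auto
  qed
  define \<psi> where "\<psi> z = the (g (Some z))" for z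
  have \<psi>: "g (Some z) = Some (\<psi> z)" "0 \<le> Im (\<psi> z)" "\<phi> (\<psi> z) = z" if "z \<in> closure U" for z
    using ex[OF that] by (auto simp: \<psi>_def)
  have \<psi>\<phi>: "\<psi> (\<phi> x) = x" if "0 \<le> Im x" for x
    using inv1[of "Some x"] that tX by (simp add: \<psi>_def)
  \<comment> \<open>Since \<open>Some\<close> is continuous and open, continuity into the sphere at
    finite values is continuity in the plane.\<close>
  have cont_lift: "continuous_on S f"
    if "continuous_map (subtopology riemann_sphere T) riemann_sphere F" "Some ` S \<subseteq> T"
      "\<And>x. x \<in> S \<Longrightarrow> F (Some x) = Some (f x)"
    for S :: "complex set" and f :: "complex \<Rightarrow> complex" and F T
  proof -
    have "continuous_map (top_of_set S) (subtopology riemann_sphere T) Some"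
      using that(2)
      by (intro continuous_map_into_subtopology continuous_map_from_subtopology continuous_map_Some) auto
    from continuous_map_compose[OF this that(1)]
    have "continuous_map (top_of_set S) riemann_sphere (\<lambda>x. Some (f x))"
      by (rule continuous_map_eq) (use that(3) in auto)
    then have "continuous_map (top_of_set S) euclidean f"
      by (subst (asm) continuous_map_Some_iff) auto
    then show ?thesis by simp
  qed
  have c\<phi>: "continuous_on ?H \<phi>"
    by (rule cont_lift[where F = "map_option \<phi>" and T = "Some ` ?H \<union> {None}"])
       (use c1 in \<open>auto simp: X_def Y_def continuous_map_in_subtopology\<close>)
  have c\<psi>: "continuous_on (closure U) \<psi>"
    by (rule cont_lift[where F = g and T = "riemann_sphere closure_of (Some ` U)"])
       (use c2 in \<open>auto simp: X_def Y_def continuous_map_in_subtopology Some_in_closure_of_iff \<psi>(1)\<close>)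
  have hol: "\<phi> holomorphic_on upper_half_plane" and bij: "bij_betw \<phi> upper_half_plane U"
    using \<phi> unfolding normalized_conformal_map_def by auto
  \<comment> \<open>This provides a holomorphic inverse on \<open>U\<close>; it has to coincide
    there with the restriction of the continuous inverse \<open>\<psi>\<close>.\<close>
  obtain k where k: "k holomorphic_on \<phi> ` upper_half_plane" "\<And>x. x \<in> upper_half_plane \<Longrightarrow> k (\<phi> x) = x"
    using holomorphic_has_inverse[OF hol open_halfspace_Im_gt[of 0] bij_betw_imp_inj_on[OF bij]] by blast
  have im: "\<phi> ` upper_half_plane = U" using bij by (simp add: bij_betw_def)
  have pos: "0 < Im (\<psi> z)" if "z \<in> U" for z
  proof -
    obtain x where "0 < Im x" "z = \<phi> x" using \<open>z \<in> U\<close> unfolding im[symmetric] by blast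
    then show ?thesis using \<psi>\<phi>[of x] by simp
  qed
  have h\<psi>: "\<psi> holomorphic_on U"
  proof (rule holomorphic_transform[OF k(1)[unfolded im]])
    fix z assume "z \<in> U"
    then obtain x where "0 < Im x" "z = \<phi> x" using \<open>z \<in> U\<close> unfolding im[symmetric] by blast
    then show "k z = \<psi> z" using \<psi>\<phi>[of x] k(2)[of x] by simp
  qed
  show thesis
  proof (rule that[of \<psi>])
    show "0 \<le> Im (\<psi> z) \<and> \<phi> (\<psi> z) = z" if "z \<in> closure U" for z
      using \<psi>(2,3)[OF that] by blast
  qed (fact c\<phi> \<psi>\<phi> c\<psi> h\<psi> pos)+
qed

section \<open>The arcsine law as an image of the uniform law\<close>

lemma nn_integral_arcsine:
  fixes F :: "real \<Rightarrow> real"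
  assumes F[measurable]: "set_borel_measurable borel {0..1} F"
  shows "(\<integral>\<^sup>+x\<in>{0..1}. ennreal (F x / sqrt (x * (1 - x))) \<partial>lborel) =
    (\<integral>\<^sup>+\<theta>\<in>{0..pi}. ennreal (F ((1 - cos \<theta>) / 2)) \<partial>lborel)"
proof -
  let ?g = "\<lambda>\<theta>::real. (1 - cos \<theta>) / 2"
  have "set_borel_measurable borel {0..1} (\<lambda>x. F x / sqrt (x * (1 - x)))"
    using F unfolding set_borel_measurable_def scaleR_conv_of_real
    by (simp add: times_divide_eq_right) measurable
  then have m: "set_borel_measurable borel {?g 0..?g pi} (\<lambda>x. F x / sqrt (x * (1 - x)))" by simp
  have "(\<integral>\<^sup>+x\<in>{0..1}. ennreal (F x / sqrt (x * (1 - x))) \<partial>lborel) =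
      (\<integral>\<^sup>+x. ennreal (F x / sqrt (x * (1 - x)) * indicator {?g 0..?g pi} x) \<partial>lborel)"
    by (intro nn_integral_cong) (auto split: split_indicator)
  \<comment> \<open>Under x = (1 - cos \<theta>) / 2 both dx/d\<theta> and sqrt (x (1 - x)) equal
    sin \<theta> / 2, so the weight becomes constant.\<close>
  also have "\<dots> = (\<integral>\<^sup>+\<theta>. ennreal (F (?g \<theta>) / sqrt (?g \<theta> * (1 - ?g \<theta>)) * (sin \<theta> / 2) * indicator {0..pi} \<theta>) \<partial>lborel)"
    by (rule nn_integral_substitution[where g = ?g and a = 0 and b = pi, OF m])
       (auto intro!: derivative_eq_intros continuous_intros sin_ge_zero)
  also have "\<dots> = (\<integral>\<^sup>+\<theta>\<in>{0..pi}. ennreal (F (?g \<theta>)) \<partial>lborel)"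
  proof (rule nn_integral_cong_AE)
    \<comment> \<open>At the two endpoints sin \<theta> vanishes and the left-hand side is 0
      whatever \<open>F\<close> is, so the integrands agree only almost everywhere.\<close>
    have "AE \<theta> in lborel. \<theta> \<noteq> 0" "AE \<theta> in lborel. \<theta> \<noteq> pi" by (rule AE_lborel_singleton)+
    then show "AE \<theta> in lborel. ennreal (F (?g \<theta>) / sqrt (?g \<theta> * (1 - ?g \<theta>)) * (sin \<theta> / 2) * indicator {0..pi} \<theta>) =
        ennreal (F (?g \<theta>)) * indicator {0..pi} \<theta>"
    proof eventually_elim
      case (elim \<theta>)
      show ?case
      proof (cases "\<theta> \<in> {0..pi}")
        case True
        then have s: "0 < sin \<theta>" using elim by (intro sin_gt_zero) auto
        have "?g \<theta> * (1 - ?g \<theta>) = (1 - (cos \<theta>)\<^sup>2) / 4" by (simp add: power2_eq_square field_simps)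
        also have "\<dots> = (sin \<theta> / 2)\<^sup>2" by (simp add: sin_squared_eq power_divide)
        finally have "sqrt (?g \<theta> * (1 - ?g \<theta>)) = sin \<theta> / 2" using s by simp
        then show ?thesis using s True by simp
      qed simp
    qed
  qed
  finally show ?thesis .
qed

text \<open>The limit measure is the image of the uniform law on [0, pi] under \<theta> -> \<phi>
  ((1 - cos \<theta>) / 2); \<open>D\<close> and \<open>G\<close> below are that law and that
  map.\<close>

lemma integral_harmonic_measure_infinity:
  fixes f :: "complex \<Rightarrow> real"
  assumes \<phi>: "continuous_on {0..1} (\<lambda>x. \<phi> (complex_of_real x))"
    and \<Gamma>: "\<Gamma> = (\<lambda>x. \<phi> (complex_of_real x)) ` {0..1}" and f: "continuous_on \<Gamma> f"
  shows "(\<integral>x. f x \<partial>harmonic_measure_infinity \<Gamma> \<phi>) =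
    1 / pi * integral {0..pi} (\<lambda>\<theta>. f (\<phi> (of_real ((1 - cos \<theta>) / 2))))"
    and "space (harmonic_measure_infinity \<Gamma> \<phi>) = \<Gamma>"
proof -
  let ?g = "\<lambda>\<theta>::real. (1 - cos \<theta>) / 2"
  let ?\<mu> = "harmonic_measure_infinity \<Gamma> \<phi>"
  have "compact \<Gamma>" unfolding \<Gamma> by (intro compact_continuous_image \<phi>) simp
  then have \<Gamma>b[measurable]: "\<Gamma> \<in> sets borel" by (rule borel_compact)
  have sR: "sets (restrict_space borel \<Gamma>) = {A \<in> sets borel. A \<subseteq> \<Gamma>}"
    using \<Gamma>b by (auto simp: sets_restrict_space image_iff)
  have sub: "sets (restrict_space borel \<Gamma>) \<subseteq> Pow \<Gamma>" using sR by auto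
  show sp: "space ?\<mu> = \<Gamma>"
    unfolding harmonic_measure_infinity_def using sub by (rule space_measure_of)
  have s\<mu>: "sets ?\<mu> = sets (restrict_space borel \<Gamma>)"
    unfolding harmonic_measure_infinity_def sets_measure_of[OF sub]
    using sets.sigma_sets_eq[of "restrict_space borel \<Gamma>"] by (simp add: space_restrict_space)
  \<comment> \<open>The default value \<open>\<phi> 0\<close> lies on the curve, so that
    \<open>G\<close> takes values in \<Gamma> everywhere and is measurable into the restricted
    space.\<close>
  define G where "G \<theta> = (if \<theta> \<in> {0..pi} then \<phi> (of_real (?g \<theta>)) else \<phi> 0)" for \<theta>
  have G\<Gamma>: "G \<theta> \<in> \<Gamma>" for \<theta>
  proof (cases "\<theta> \<in> {0..pi}")
    case True
    have "?g \<theta> \<in> {0..1}" by simp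
    then show ?thesis using True unfolding G_def \<Gamma> by (auto simp del: of_real_divide of_real_diff)
  next
    case False
    then show ?thesis unfolding G_def \<Gamma> by (auto intro!: image_eqI[of _ _ 0])
  qed
  have Gc: "continuous_on {0..pi} (\<lambda>\<theta>. \<phi> (of_real (?g \<theta>)))"
    by (rule continuous_on_compose2[OF \<phi>, where f = ?g]) (auto intro!: continuous_intros)
  have Gb[measurable]: "G \<in> borel_measurable borel"
    unfolding G_def using Gc by (intro borel_measurable_continuous_on_if) auto
  have Gm[measurable]: "G \<in> measurable lborel (restrict_space borel \<Gamma>)"
    by (rule measurable_restrict_space2) (use G\<Gamma> in auto)
  define D where "D = density lborel (\<lambda>\<theta>. ennreal (1 / pi * indicator {0..pi} \<theta>))"
  have Gm'[measurable]: "G \<in> measurable D (restrict_space borel \<Gamma>)" using Gm by (simp add: D_def)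
  have "?\<mu> = distr D (restrict_space borel \<Gamma>) G"
  proof (rule measure_eqI)
    show "sets ?\<mu> = sets (distr D (restrict_space borel \<Gamma>) G)" by (simp add: s\<mu>)
    fix E assume "E \<in> sets ?\<mu>"
    then have ER[measurable]: "E \<in> sets (restrict_space borel \<Gamma>)" and E[measurable]: "E \<in> sets borel" and E\<Gamma>: "E \<subseteq> \<Gamma>"
      unfolding s\<mu> sR by auto
    define \<phi>' where "\<phi>' x = (if x \<in> {0..1} then \<phi> (complex_of_real x) else 0)" for x
    have [measurable]: "\<phi>' \<in> borel_measurable borel"
      unfolding \<phi>'_def using \<phi> by (intro borel_measurable_continuous_on_if) auto
    have "(\<lambda>x. indicator {0..1} x *\<^sub>R (indicator E (\<phi> (complex_of_real x)) :: real)) =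
        (\<lambda>x. indicator {0..1} x *\<^sub>R indicator E (\<phi>' x))"
      by (auto simp: \<phi>'_def split: split_indicator)
    then have mE: "set_borel_measurable borel {0..1} (\<lambda>x. indicator E (\<phi> (complex_of_real x)) :: real)"
      unfolding set_borel_measurable_def by simp
    have "emeasure ?\<mu> E = ennreal (1 / pi) *
        (\<integral>\<^sup>+x\<in>{0..1}. ennreal (indicator E (\<phi> (complex_of_real x)) / sqrt (x * (1 - x))) \<partial>lborel)"
      by (rule emeasure_harmonic_measure_infinity[OF \<phi> E E\<Gamma> \<Gamma>b])
    also have "\<dots> = ennreal (1 / pi) * (\<integral>\<^sup>+\<theta>\<in>{0..pi}. ennreal (indicator E (\<phi> (of_real (?g \<theta>)))) \<partial>lborel)"
      by (subst nn_integral_arcsine[OF mE]) auto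
    also have "\<dots> = ennreal (1 / pi) * (\<integral>\<^sup>+\<theta>. indicator {0..pi} \<theta> * indicator (G -` E) \<theta> \<partial>lborel)"
    proof (rule arg_cong[where f = "\<lambda>u. ennreal (1 / pi) * u"], rule nn_integral_cong)
      fix \<theta>
      show "ennreal (indicator E (\<phi> (of_real (?g \<theta>)))) * indicator {0..pi} \<theta> =
          indicator {0..pi} \<theta> * indicator (G -` E) \<theta>"
        by (cases "\<theta> \<in> {0..pi}")
           (simp_all add: G_def indicator_def del: of_real_divide of_real_diff)
    qed
    also have "\<dots> = (\<integral>\<^sup>+\<theta>. ennreal (1 / pi) * (indicator {0..pi} \<theta> * indicator (G -` E) \<theta>) \<partial>lborel)"
      using measurable_sets_borel[OF Gb E] by (intro nn_integral_cmult[symmetric]) measurable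
    also have "\<dots> = (\<integral>\<^sup>+\<theta>. ennreal (1 / pi * indicator {0..pi} \<theta>) * indicator (G -` E) \<theta> \<partial>lborel)"
      by (intro nn_integral_cong) (auto split: split_indicator)
    also have "\<dots> = emeasure D (G -` E)"
      using measurable_sets_borel[OF Gb E] unfolding D_def by (subst emeasure_density) auto
    also have "\<dots> = emeasure (distr D (restrict_space borel \<Gamma>) G) E"
      using emeasure_distr[OF Gm' ER] by (simp add: D_def)
    finally show "emeasure ?\<mu> E = emeasure (distr D (restrict_space borel \<Gamma>) G) E" .
  qed
  moreover have [measurable]: "f \<in> borel_measurable (restrict_space borel \<Gamma>)"
    using f by (rule borel_measurable_continuous_on_restrict)
  ultimately have "(\<integral>x. f x \<partial>?\<mu>) = (\<integral>\<theta>. f (G \<theta>) \<partial>D)" by (simp add: integral_distr)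
  also have "\<dots> = (\<integral>\<theta>. (1 / pi * indicator {0..pi} \<theta>) *\<^sub>R f (G \<theta>) \<partial>lborel)"
    unfolding D_def by (rule integral_density) (auto intro: measurable_compose[OF Gm])
  also have "\<dots> = (\<integral>\<theta>. 1 / pi * (indicator {0..pi} \<theta> *\<^sub>R f (\<phi> (of_real (?g \<theta>)))) \<partial>lborel)"
    by (intro Bochner_Integration.integral_cong) (auto simp: G_def split: split_indicator)
  also have "\<dots> = 1 / pi * (LINT \<theta>:{0..pi}|lborel. f (\<phi> (of_real (?g \<theta>))))"
    unfolding set_lebesgue_integral_def by (rule integral_mult_right_zero)
  also have "(LINT \<theta>:{0..pi}|lborel. f (\<phi> (of_real (?g \<theta>)))) = integral {0..pi} (\<lambda>\<theta>. f (\<phi> (of_real (?g \<theta>))))"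
  proof (rule set_borel_integral_eq_integral(2), rule borel_integrable_atLeastAtMost')
    show "continuous_on {0..pi} (\<lambda>\<theta>. f (\<phi> (of_real (?g \<theta>))))"
    proof (rule continuous_on_compose2[OF f Gc])
      show "(\<lambda>\<theta>. \<phi> (of_real (?g \<theta>))) ` {0..pi} \<subseteq> \<Gamma>"
      proof (rule image_subsetI)
        fix \<theta> :: real assume "\<theta> \<in> {0..pi}"
        then show "\<phi> (of_real (?g \<theta>)) \<in> \<Gamma>" using G\<Gamma>[of \<theta>] by (simp add: G_def)
      qed
    qed
  qed
  finally show "(\<integral>x. f x \<partial>?\<mu>) = 1 / pi * integral {0..pi} (\<lambda>\<theta>. f (\<phi> (of_real (?g \<theta>))))" .
qed

section \<open>Weak convergence of the hitting distributions\<close>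

text \<open>Consecutive linear pieces agree at the knots. The half-open intervals leave only the
  point 0 uncovered, and \<open>W 0 = 0\<close> makes the resulting value correct there.\<close>

lemma continuous_on_interpolation:
  assumes t: "t 0 = 0" "t n = 1" "\<And>k. k < n \<Longrightarrow> t k < t (Suc k)" and "W 0 = 0"
  shows "continuous_on {0..1} (interpolation n t W)"
proof -
  have mono: "t i \<le> t j" if "i \<le> j" "j \<le> n" for i j
    using that
  proof (induction j rule: dec_induct)
    case (step m)
    then show ?case using t(3)[of m] by simp
  qed simp
  let ?L = "\<lambda>k x. (t k - x) / (t k - t (k - 1)) * W (k - 1) + (x - t (k - 1)) / (t k - t (k - 1)) * W k"
  have seg: "interpolation n t W x = ?L k x" if "k \<in> {1..n}" "t (k - 1) < x" "x \<le> t k" for k x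
  proof -
    define F where "F i = indicator {t (i - 1)<..t i} x * ?L i x" for i
    have "interpolation n t W x = (\<Sum>i\<in>{k}. F i)"
      unfolding interpolation_def F_def[symmetric]
    proof (rule sum.mono_neutral_right)
      show "\<forall>i\<in>{1..n} - {k}. F i = 0"
      proof
        fix i assume i: "i \<in> {1..n} - {k}"
        show "F i = 0"
        proof (cases "i < k")
          case True
          then have "t i \<le> t (k - 1)" using that by (intro mono) auto
          then show ?thesis using that by (simp add: F_def)
        next
          case False
          then have "t k \<le> t (i - 1)" using that i by (intro mono) auto
          then show ?thesis using that by (simp add: F_def)
        qed
      qed
    qed (use that in auto)
    also have "\<dots> = ?L k x" using that by (simp add: F_def)
    finally show ?thesis .
  qed
  have knot: "interpolation n t W (t k) = W k" if "k \<le> n" for k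
  proof (cases k)
    case 0
    \<comment> \<open>No interval of the partition contains 0, so the sum vanishes there.\<close>
    have "interpolation n t W 0 = 0"
      unfolding interpolation_def
    proof (rule sum.neutral, rule ballI)
      fix i assume "i \<in> {1..n}"
      then have "t 0 \<le> t (i - 1)" by (intro mono) auto
      then show "indicator {t (i - 1)<..t i} 0 * ?L i 0 = 0" using t(1) by simp
    qed
    then show ?thesis using 0 t(1) \<open>W 0 = 0\<close> by simp
  next
    case (Suc j)
    then have "t j < t k" using t(3)[of j] that by simp
    moreover from this have "interpolation n t W (t k) = ?L k (t k)" using that Suc by (intro seg) auto
    ultimately show ?thesis using Suc by simp
  qed
  have "continuous_on {0..t k} (interpolation n t W)" if "k \<le> n" for k
    using that
  proof (induction k)
    case 0
    then show ?case using t(1) by simp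
  next
    case (Suc k)
    have less: "t k < t (Suc k)" using t(3) Suc.prems by simp
    have "continuous_on {t k..t (Suc k)} (?L (Suc k))" using less by (intro continuous_intros) auto
    then have "continuous_on {t k..t (Suc k)} (interpolation n t W)"
    proof (rule continuous_on_eq)
      fix x assume x: "x \<in> {t k..t (Suc k)}"
      show "?L (Suc k) x = interpolation n t W x"
      proof (cases "x = t k")
        case True
        then show ?thesis using knot[of k] Suc.prems less by simp
      next
        case False
        then show ?thesis using seg[of "Suc k" x] x Suc.prems by simp
      qed
    qed
    moreover have "{0..t (Suc k)} = {0..t k} \<union> {t k..t (Suc k)}"
      using mono[of 0 k] less t(1) Suc.prems by auto
    ultimately show ?case using Suc by (simp add: continuous_on_closed_Un)
  qed
  from this[of n] show ?thesis using t(2) by simp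
qed

text \<open>The preimages under \<open>f\<close> and \<open>g\<close> differ by a subset of a null
  set, which the completion makes measurable. It is meant for the hitting point, which is determined
  by the path only almost surely.\<close>

lemma measurable_completion_AE_cong:
  assumes g: "g \<in> measurable M N" and f: "f \<in> space M \<rightarrow> space N" and eq: "AE x in M. f x = g x"
  shows "f \<in> measurable (completion M) N"
proof (rule measurableI)
  fix A assume A[measurable]: "A \<in> sets N"
  have [measurable]: "g \<in> measurable (completion M) N" using g by (rule measurable_completion)
  have "Measurable.pred (completion M) (\<lambda>x. f x \<noteq> g x)"
    "Measurable.pred (completion M) (\<lambda>x. f x \<noteq> g x \<and> f x \<in> A)"
    using eq by (auto intro!: sets_completion_AE elim!: eventually_mono)
  then have "Measurable.pred (completion M) (\<lambda>x. (g x \<in> A \<and> \<not> f x \<noteq> g x) \<or> (f x \<noteq> g x \<and> f x \<in> A))"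
    by measurable
  also have "(\<lambda>x. (g x \<in> A \<and> \<not> f x \<noteq> g x) \<or> (f x \<noteq> g x \<and> f x \<in> A)) = (\<lambda>x. f x \<in> A)" by auto
  finally have "{x \<in> space (completion M). f x \<in> A} \<in> sets (completion M)" by (simp add: pred_def)
  then show "f -` A \<inter> space (completion M) \<in> sets (completion M)"
    by (simp add: vimage_def Int_def conj_commute)
qed (use f in auto)

lemma strip_reflection_in_graph_iff:
  "strip_reflection w \<in> graph_curve \<gamma> \<longleftrightarrow> Im w = \<gamma> (Re (strip_reflection w))"
proof
  assume "Im w = \<gamma> (Re (strip_reflection w))"
  then have "strip_reflection w = Complex (Re (strip_reflection w)) (\<gamma> (Re (strip_reflection w)))"
    by (simp add: complex_eq_iff strip_reflection_sel(2))
  then show "strip_reflection w \<in> graph_curve \<gamma>"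
    unfolding graph_curve_def using Re_strip_reflection_bounds[of w] by blast
next
  assume "strip_reflection w \<in> graph_curve \<gamma>"
  then obtain x where "strip_reflection w = Complex x (\<gamma> x)" by (auto simp: graph_curve_def)
  then show "Im w = \<gamma> (Re (strip_reflection w))" by (metis complex.sel strip_reflection_sel(2))
qed

lemma compact_graph_curve:
  assumes "continuous_on {0..1} \<gamma>"
  shows "compact (graph_curve \<gamma>)"
proof -
  have "graph_curve \<gamma> = (\<lambda>x. Complex x (\<gamma> x)) ` {0..1}" by (auto simp: graph_curve_def)
  moreover have "continuous_on {0..1} (\<lambda>x. Complex x (\<gamma> x))"
    unfolding Complex_eq by (intro continuous_intros assms)
  ultimately show ?thesis by (simp add: compact_continuous_image)
qed

text \<open>Hitting the curve is the equation u = 0, leaving the domain the inequality u \<ge> 0. As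
  the path starts with u < 0, the intermediate value theorem forces u = 0 at the first exit, and an
  earlier zero would be an earlier exit.\<close>

lemma hitting_time_eq_exit_time:
  assumes \<gamma>: "continuous_on {0..1} \<gamma>" and b: "continuous_on {0..} (\<lambda>t. B t \<omega>)"
    and start: "B 0 \<omega> \<in> periodic_domain_below \<gamma>"
    and exit: "\<exists>t\<ge>0. B t \<omega> \<notin> periodic_domain_below \<gamma>"
  shows "hitting_time B (graph_curve \<gamma>) \<omega> = (LEAST t. 0 \<le> t \<and> B t \<omega> \<notin> periodic_domain_below \<gamma>)"
    and "strip_reflection (B (hitting_time B (graph_curve \<gamma>) \<omega>) \<omega>) \<in> graph_curve \<gamma>"
proof -
  let ?F = "- periodic_domain_below \<gamma>"
  define \<tau> where "\<tau> = (LEAST t. 0 \<le> t \<and> B t \<omega> \<in> ?F)"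
  have F: "closed ?F" using open_periodic_domain_below[OF \<gamma>] by (rule closed_Compl)
  obtain t0 where t0: "0 \<le> t0" "B t0 \<omega> \<in> ?F" using exit by auto
  note \<tau> = first_hitting_time[OF b F t0, folded \<tau>_def]
  define u where "u t = Im (B t \<omega>) - \<gamma> (Re (strip_reflection (B t \<omega>)))" for t
  have u: "B t \<omega> \<in> ?F \<longleftrightarrow> 0 \<le> u t" for t by (auto simp: u_def periodic_domain_below_def)
  have "continuous_on {0..\<tau>} u"
    unfolding u_def using continuous_on_subset[OF b, of "{0..\<tau>}"]
    by (intro continuous_intros continuous_on_compose2[OF continuous_on_strip_reflection_graph[OF \<gamma>, of UNIV]]) auto
  then obtain x where x: "0 \<le> x" "x \<le> \<tau>" "u x = 0"
    using IVT'[of u 0 0 \<tau>] \<tau>(1,2) start u[of \<tau>] u[of 0] by auto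
  have "\<tau> \<le> x" using \<tau>(3)[of x] x u[of x] by simp
  then have u\<tau>: "u \<tau> = 0" using x by simp
  have hit: "strip_reflection (B t \<omega>) \<in> graph_curve \<gamma> \<longleftrightarrow> u t = 0" for t
    unfolding strip_reflection_in_graph_iff by (auto simp: u_def)
  have "hitting_time B (graph_curve \<gamma>) \<omega> = \<tau>"
    unfolding hitting_time_def hit
  proof (rule Least_equality)
    fix t assume "0 \<le> t \<and> u t = 0"
    then show "\<tau> \<le> t" using \<tau>(3)[of t] u[of t] by simp
  qed (use \<tau>(1) u\<tau> in auto)
  then show "hitting_time B (graph_curve \<gamma>) \<omega> = (LEAST t. 0 \<le> t \<and> B t \<omega> \<notin> periodic_domain_below \<gamma>)"
    "strip_reflection (B (hitting_time B (graph_curve \<gamma>) \<omega>) \<omega>) \<in> graph_curve \<gamma>"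
    using hit[of \<tau>] u\<tau> by (auto simp: \<tau>_def)
qed

text \<open>Re h at the exit point has expectation exactly Re (h z), and \<open>f\<close> is within
  \<open>e\<close> of Re h on the curve. The remaining work is to move between the hitting
  distribution on the completed space and the measurable exit point \<open>P\<close>.\<close>

lemma hitting_distribution_integral_near:
  fixes f :: "complex \<Rightarrow> real"
  assumes bm: "planar_brownian_motion M B z" and z: "z \<in> domain_below \<gamma>"
    and \<gamma>: "continuous_on {0..1} \<gamma>"
    and h_cont: "continuous_on (closure (domain_below \<gamma>)) h"
    and h_hol: "h holomorphic_on domain_below \<gamma>"
    and h_real: "\<And>w. Re w \<in> {0, 1} \<Longrightarrow> Im w < \<gamma> (Re w) \<Longrightarrow> h w \<in> \<real>"
    and hC: "\<And>w. w \<in> closure (domain_below \<gamma>) \<Longrightarrow> cmod (h w) \<le> C"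
    and f: "continuous_on (graph_curve \<gamma>) f"
    and near: "\<And>w. w \<in> graph_curve \<gamma> \<Longrightarrow> \<bar>f w - Re (h w)\<bar> \<le> e"
  shows "\<bar>(\<integral>w. f w \<partial>hitting_distribution M B (graph_curve \<gamma>)) - Re (h z)\<bar> \<le> e"
proof -
  interpret prob_space M using bm unfolding planar_brownian_motion_def by blast
  let ?V = "periodic_domain_below \<gamma>" and ?\<Gamma> = "graph_curve \<gamma>"
  have V: "open ?V" by (rule open_periodic_domain_below[OF \<gamma>])
  have \<Gamma>[measurable]: "?\<Gamma> \<in> sets borel" using compact_graph_curve[OF \<gamma>] by (rule borel_compact)
  have zid: "strip_reflection z = z" using z by (intro strip_reflection_id) (auto simp: domain_below_def)
  have zV: "z \<in> ?V" using z zid by (simp add: periodic_domain_below_def domain_below_def)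
  \<comment> \<open>Above the maximum of \<gamma> the path is certainly outside the periodic
    domain.\<close>
  obtain c where c: "\<And>x. x \<in> {0..1} \<Longrightarrow> \<gamma> x \<le> c"
  proof -
    have "bounded (\<gamma> ` {0..1})" by (intro compact_imp_bounded compact_continuous_image \<gamma>) simp
    then obtain c where "\<forall>y\<in>\<gamma> ` {0..1}. \<bar>y\<bar> \<le> c" unfolding bounded_real by blast
    then show thesis using abs_le_D1 by (intro that[of c]) blast
  qed
  have exit: "AE \<omega> in M. \<exists>t\<ge>0. B t \<omega> \<notin> ?V"
    using planar_brownian_motion_exits_lower_half_plane[OF bm, of c]
  proof eventually_elim
    case (elim \<omega>)
    then obtain t where "0 \<le> t" "c \<le> Im (B t \<omega>)" by blast
    then show ?case using c[of "Re (strip_reflection (B t \<omega>))"] Re_strip_reflection_bounds[of "B t \<omega>"]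
      by (auto simp: periodic_domain_below_def not_less intro!: exI[of _ t])
  qed
  obtain P where P[measurable]: "P \<in> borel_measurable M"
    and P_exit: "AE \<omega> in M. P \<omega> = B (LEAST t. 0 \<le> t \<and> B t \<omega> \<notin> ?V) \<omega>"
    and P_int: "\<And>H g C. continuous_on UNIV H \<Longrightarrow> (\<And>w. \<bar>H w\<bar> \<le> C) \<Longrightarrow> g holomorphic_on ?V \<Longrightarrow>
       (\<And>w. w \<in> ?V \<Longrightarrow> cmod (g w) \<le> C) \<Longrightarrow> (\<And>w. w \<in> ?V \<Longrightarrow> H w = Re (g w)) \<Longrightarrow>
       (\<integral>\<omega>. H (P \<omega>) \<partial>M) = H z"
    using planar_brownian_motion_exit_point[OF bm V exit] by blast
  define X where "X \<omega> = strip_reflection (B (hitting_time B ?\<Gamma> \<omega>) \<omega>)" for \<omega>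
  define Y where "Y \<omega> = strip_reflection (P \<omega>)" for \<omega>
  have [measurable]: "strip_reflection \<in> borel_measurable borel"
    by (intro borel_measurable_continuous_onI continuous_on_strip_reflection)
  have Y[measurable]: "Y \<in> borel_measurable M" unfolding Y_def by measurable
  have XY: "AE \<omega> in M. X \<omega> = Y \<omega> \<and> Y \<omega> \<in> ?\<Gamma>"
  proof -
    have "AE \<omega> in M. continuous_on {0..} (\<lambda>t. B t \<omega>)" "AE \<omega> in M. B 0 \<omega> = z"
      using bm unfolding planar_brownian_motion_def by blast+
    then show ?thesis using exit P_exit
    proof eventually_elim
      case (elim \<omega>)
      have "B 0 \<omega> \<in> ?V" using elim zV by simp
      from hitting_time_eq_exit_time[where B = B and \<omega> = \<omega>, OF \<gamma> elim(1) this elim(3)] elim(4)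
      show ?case by (simp add: X_def Y_def)
    qed
  qed
  have XY1: "AE \<omega> in M. X \<omega> = Y \<omega>" and Y\<Gamma>: "AE \<omega> in M. Y \<omega> \<in> ?\<Gamma>" using XY by auto
  have Xm: "X \<in> borel_measurable (completion M)"
    by (rule measurable_completion_AE_cong[OF Y _ XY1]) auto
  have Ym: "Y \<in> borel_measurable (completion M)" by (rule measurable_completion[OF Y])
  \<comment> \<open>\<open>f\<close> is controlled only on the curve; its extension by 0 is Borel on
    the whole plane.\<close>
  define f' where "f' w = (if w \<in> ?\<Gamma> then f w else 0)" for w
  have [measurable]: "f' \<in> borel_measurable borel"
    unfolding f'_def using f \<Gamma> by (intro borel_measurable_continuous_on_if) auto
  have "(\<integral>w. f w \<partial>hitting_distribution M B ?\<Gamma>) =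
      (\<integral>w. indicator ?\<Gamma> w *\<^sub>R f w \<partial>distr (completion M) borel X)"
    unfolding hitting_distribution_def X_def[symmetric]
    by (rule integral_restrict_space) simp
  also have "\<dots> = (\<integral>w. f' w \<partial>distr (completion M) borel X)"
    by (intro Bochner_Integration.integral_cong) (auto simp: f'_def)
  also have "distr (completion M) borel X = distr (completion M) borel Y"
    by (rule distr_cong_AE[OF refl refl AE_completion[OF XY1] Xm Ym])
  also have "(\<integral>w. f' w \<partial>distr (completion M) borel Y) = (\<integral>\<omega>. f' (Y \<omega>) \<partial>completion M)"
    using Ym by (rule integral_distr) simp
  also have "\<dots> = (\<integral>\<omega>. f' (Y \<omega>) \<partial>M)" by (rule integral_completion) simp
  finally have int_f: "(\<integral>w. f w \<partial>hitting_distribution M B ?\<Gamma>) = (\<integral>\<omega>. f' (Y \<omega>) \<partial>M)" .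

  \<comment> \<open>The exit theorem asks for a bounded continuous function on the whole plane,
    while \<open>h\<close> is controlled only on the closure of the domain. Folding into the strip
    and lowering to the curve whatever lies above it retracts the plane onto that closure;
    \<open>L\<close> is the plain reflection inside the periodic domain and on its boundary
    curve.\<close>
  define L where "L w = Complex (Re (strip_reflection w)) (min (Im w) (\<gamma> (Re (strip_reflection w))))" for w
  have Lcl: "L w \<in> closure (domain_below \<gamma>)" for w
    using Re_strip_reflection_bounds[of w] by (simp add: L_def closure_domain_below[OF \<gamma>])
  have L_id: "L w = strip_reflection w" if "Im w \<le> \<gamma> (Re (strip_reflection w))" for w
    using that by (simp add: L_def complex_eq_iff strip_reflection_sel(2))
  have Lc: "continuous_on UNIV L"
    unfolding L_def Complex_eq
    by (intro continuous_intros continuous_on_strip_reflection continuous_on_strip_reflection_graph \<gamma>)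
  define H where "H w = Re (h (L w))" for w
  have Hc: "continuous_on UNIV H"
    unfolding H_def using Lcl by (intro continuous_intros continuous_on_compose2[OF h_cont Lc]) auto
  have HC: "\<bar>H w\<bar> \<le> C" for w
    using abs_Re_le_cmod[of "h (L w)"] hC[OF Lcl[of w]] by (simp add: H_def)
  have ext: "cmod (strip_extension h w) \<le> C" "H w = Re (strip_extension h w)" if "w \<in> ?V" for w
    using that hC[OF Lcl[of w]] L_id[of w] by (auto simp: H_def periodic_domain_below_def)
  have int_H: "(\<integral>\<omega>. H (P \<omega>) \<partial>M) = H z"
    by (rule P_int[OF Hc HC strip_extension_holomorphic[OF \<gamma> h_cont h_hol h_real] ext])
  have Hz: "H z = Re (h z)"
    using L_id[of z] zV zid by (simp add: H_def periodic_domain_below_def)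
  have fH: "AE \<omega> in M. \<bar>f' (Y \<omega>) - H (P \<omega>)\<bar> \<le> e"
    using Y\<Gamma>
  proof eventually_elim
    case (elim \<omega>)
    then have "Im (P \<omega>) = \<gamma> (Re (strip_reflection (P \<omega>)))"
      by (simp add: Y_def strip_reflection_in_graph_iff)
    then have "H (P \<omega>) = Re (h (Y \<omega>))" using L_id[of "P \<omega>"] by (simp add: H_def Y_def)
    then show ?case using near[OF elim] elim by (simp add: f'_def)
  qed
  have [measurable]: "H \<in> borel_measurable borel" using Hc by (rule borel_measurable_continuous_onI)
  have iH: "integrable M (\<lambda>\<omega>. H (P \<omega>))" by (rule integrable_const_bound[where B = C]) (use HC in auto)
  have "AE \<omega> in M. norm (f' (Y \<omega>)) \<le> C + e"
    using fH
  proof eventually_elim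
    case (elim \<omega>)
    then show ?case using HC[of "P \<omega>"] by simp
  qed
  then have "integrable M (\<lambda>\<omega>. f' (Y \<omega>))"
    by (rule integrable_const_bound) simp
  then have "\<bar>(\<integral>\<omega>. f' (Y \<omega>) \<partial>M) - (\<integral>\<omega>. H (P \<omega>) \<partial>M)\<bar> = \<bar>\<integral>\<omega>. f' (Y \<omega>) - H (P \<omega>) \<partial>M\<bar>"
    using iH by simp
  also have "\<dots> \<le> (\<integral>\<omega>. \<bar>f' (Y \<omega>) - H (P \<omega>)\<bar> \<partial>M)" by (rule integral_abs_bound)
  also have "\<dots> \<le> (\<integral>\<omega>. e \<partial>M)"
    using fH \<open>integrable M (\<lambda>\<omega>. f' (Y \<omega>))\<close> iH by (intro integral_mono_AE) auto
  finally show ?thesis by (simp add: int_f int_H Hz prob_space)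
qed

lemma filterlim_half_disc_map_at_infinity:
  assumes \<psi>: "filterlim \<psi> at_infinity F" and upper: "eventually (\<lambda>z. 0 \<le> Im (\<psi> z)) F"
  shows "((\<lambda>z. half_disc_map (\<psi> z)) \<longlongrightarrow> 0) F"
proof (rule Lim_null_comparison)
  have "eventually (\<lambda>z. 1 \<le> norm (\<psi> z)) F"
    using \<psi> filterlim_at_infinity[of 0 \<psi> F] by simp
  then show "eventually (\<lambda>z. norm (half_disc_map (\<psi> z)) \<le> norm (inverse (\<psi> z))) F"
    using upper
  proof eventually_elim
    case (elim z)
    have "cmod (half_disc_map (\<psi> z)) * cmod (\<psi> z) \<le> cmod (half_disc_map (\<psi> z)) * (cmod (\<psi> z) + cmod (\<psi> z - 1))"
      by (intro mult_left_mono) auto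
    also have "\<dots> \<le> 1" using elim by (intro norm_half_disc_map_le)
    finally have "cmod (half_disc_map (\<psi> z)) \<le> 1 / cmod (\<psi> z)"
      using elim(1) by (subst pos_le_divide_eq) auto
    then show ?case by (simp add: norm_divide inverse_eq_divide)
  qed
  have "((\<lambda>z. inverse (\<psi> z)) \<longlongrightarrow> 0) F"
    by (rule filterlim_compose[OF tendsto_inverse_0 \<psi>])
  then show "((\<lambda>z. norm (inverse (\<psi> z))) \<longlongrightarrow> 0) F" by (rule tendsto_norm_zero)
qed

theorem theorem4p1:
  fixes n :: nat and t W :: "nat \<Rightarrow> real" and \<gamma> :: "real \<Rightarrow> real"
    and U \<Gamma> :: "complex set"
    and M :: "complex \<Rightarrow> 'a measure" and B :: "complex \<Rightarrow> real \<Rightarrow> 'a \<Rightarrow> complex"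
    and \<phi> :: "complex \<Rightarrow> complex"
  assumes "n \<ge> 1"
    and "t 0 = 0" and "t n = 1" and "\<And>k. k < n \<Longrightarrow> t k < t (Suc k)"
    and "W 0 = 0" and "W n = 0"
    and "\<gamma> = interpolation n t W"
    and "U = domain_below \<gamma>" and "\<Gamma> = graph_curve \<gamma>"
    and "\<And>z. z \<in> U \<Longrightarrow> planar_brownian_motion (M z) (B z) z"
    and "normalized_conformal_map U \<Gamma> \<phi>"
  shows "weakly_converges (\<lambda>z. hitting_distribution (M z) (B z) \<Gamma>)
           (harmonic_measure_infinity \<Gamma> \<phi>) (inf at_infinity (principal U))"
proof -
  let ?F = "inf at_infinity (principal U)"
  note U = \<open>U = domain_below \<gamma>\<close> and \<Gamma> = \<open>\<Gamma> = graph_curve \<gamma>\<close>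
  have \<gamma>: "continuous_on {0..1} \<gamma>"
    unfolding \<open>\<gamma> = _\<close> by (rule continuous_on_interpolation) fact+
  have clU: "closure U = {w. 0 \<le> Re w \<and> Re w \<le> 1 \<and> Im w \<le> \<gamma> (Re w)}"
    unfolding U by (rule closure_domain_below[OF \<gamma>])
  obtain \<psi> where \<phi>c: "continuous_on {z. 0 \<le> Im z} \<phi>"
    and \<psi>\<phi>: "\<And>x. 0 \<le> Im x \<Longrightarrow> \<psi> (\<phi> x) = x"
    and \<psi>c: "continuous_on (closure U) \<psi>"
    and \<phi>\<psi>: "\<And>z. z \<in> closure U \<Longrightarrow> 0 \<le> Im (\<psi> z) \<and> \<phi> (\<psi> z) = z"
    and \<psi>h: "\<psi> holomorphic_on U" and \<psi>U: "\<And>z. z \<in> U \<Longrightarrow> 0 < Im (\<psi> z)"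
    using normalized_conformal_mapE[OF \<open>normalized_conformal_map U \<Gamma> \<phi>\<close>] by blast
  have bij: "\<phi> ` upper_half_plane = U" "\<phi> ` complex_of_real ` {0..1} = \<Gamma>"
    using \<open>normalized_conformal_map U \<Gamma> \<phi>\<close>
    unfolding normalized_conformal_map_def bij_betw_def by auto
  have \<Gamma>': "\<Gamma> = (\<lambda>x. \<phi> (complex_of_real x)) ` {0..1}" using bij(2) by (simp add: image_image)
  have \<phi>01: "continuous_on {0..1} (\<lambda>x. \<phi> (complex_of_real x))"
    by (rule continuous_on_compose2[OF \<phi>c]) (auto intro!: continuous_intros)
  \<comment> \<open>\<phi> is bounded on closed half-discs by compactness, so a point of
    \<open>U\<close> of large modulus cannot come from a bounded preimage.\<close>
  have \<psi>_inf: "filterlim \<psi> at_infinity ?F"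
    unfolding filterlim_at_infinity[OF order_refl]
  proof (intro allI impI)
    fix r :: real assume "0 < r"
    have "compact ({z. 0 \<le> Im z} \<inter> cball 0 r)"
      by (intro closed_Int_compact closed_halfspace_Im_ge compact_cball)
    then have "bounded (\<phi> ` ({z. 0 \<le> Im z} \<inter> cball 0 r))"
      using \<phi>c by (intro compact_imp_bounded compact_continuous_image) (auto intro: continuous_on_subset)
    then obtain K where "\<forall>w\<in>\<phi> ` ({z. 0 \<le> Im z} \<inter> cball 0 r). cmod w \<le> K"
      unfolding bounded_iff by blast
    then have K: "cmod (\<phi> z) \<le> K" if "0 \<le> Im z" "cmod z \<le> r" for z using that by auto
    have "eventually (\<lambda>z. K + 1 \<le> cmod z) at_infinity"
      unfolding eventually_at_infinity by blast
    then show "eventually (\<lambda>z. r \<le> cmod (\<psi> z)) ?F"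
      unfolding eventually_inf_principal
    proof eventually_elim
      case (elim z)
      show ?case
      proof
        assume "z \<in> U"
        then have "0 \<le> Im (\<psi> z)" "\<phi> (\<psi> z) = z" using \<phi>\<psi>[of z] closure_subset by auto
        then show "r \<le> cmod (\<psi> z)" using K[of "\<psi> z"] elim by fastforce
      qed
    qed
  qed
  have inU: "eventually (\<lambda>z. z \<in> U) ?F" by (simp add: eventually_inf_principal)
  have s_lim: "((\<lambda>z. half_disc_map (\<psi> z)) \<longlongrightarrow> 0) ?F"
    by (rule filterlim_half_disc_map_at_infinity[OF \<psi>_inf eventually_mono[OF inU]])
       (use \<psi>U less_imp_le in blast)
  have space: "space (harmonic_measure_infinity \<Gamma> \<phi>) = \<Gamma>"
    by (rule integral_harmonic_measure_infinity(2)[OF \<phi>01 \<Gamma>' continuous_on_const])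
  show ?thesis
    unfolding weakly_converges_def space
  proof (intro allI impI, elim conjE)
    fix f :: "complex \<Rightarrow> real" assume f: "continuous_on \<Gamma> f"
    let ?I = "\<integral>x. f x \<partial>harmonic_measure_infinity \<Gamma> \<phi>"
    let ?f = "\<lambda>x. f (\<phi> (complex_of_real x))"
    have fc: "continuous_on {0..1} ?f"
      by (rule continuous_on_compose2[OF f \<phi>01]) (simp add: \<Gamma>')
    show "((\<lambda>z. \<integral>x. f x \<partial>hitting_distribution (M z) (B z) \<Gamma>) \<longlongrightarrow> ?I) ?F"
    proof (rule tendstoI)
      fix \<epsilon> :: real assume "0 < \<epsilon>"
      \<comment> \<open>Three errors of size at most e are added at the end: hitting integral
        against Re (h z), Re (h z) against q(0), and q(0) against the limit integral.\<close>
      define e where "e = \<epsilon> / 4"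
      have e: "0 < e" using \<open>0 < \<epsilon>\<close> by (simp add: e_def)
      obtain q :: "complex poly" where q: "\<And>i. coeff q i \<in> \<real>"
        and fq: "\<And>\<theta>. \<bar>?f ((1 - cos \<theta>) / 2) - Re (poly q (cis \<theta>))\<bar> < e"
        using cosine_polynomial_approximation[OF fc e] by blast
      define h where "h z = poly q (half_disc_map (\<psi> z))" for z
      have h_cont: "continuous_on (closure U) h"
        unfolding h_def
        by (intro continuous_intros continuous_on_compose2[OF continuous_on_half_disc_map \<psi>c])
           (use \<phi>\<psi> in auto)
      have "(\<lambda>z. half_disc_map (\<psi> z)) holomorphic_on U"
        by (rule holomorphic_on_compose_gen[OF \<psi>h holomorphic_on_half_disc_map, unfolded o_def])
           (use \<psi>U in auto)
      then have h_hol: "h holomorphic_on U"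
        unfolding h_def by (intro poly_holomorphic_on)
      \<comment> \<open>A side point below the curve is outside \<open>U\<close> and outside
        \<Gamma>, so its preimage is real and outside [0,1]. There the half-disc map is real, and so
        is \<open>q\<close>.\<close>
      have h_real: "h w \<in> \<real>" if "Re w \<in> {0, 1}" "Im w < \<gamma> (Re w)" for w
      proof -
        have w: "w \<in> closure U" using that by (auto simp: clU)
        have "w \<notin> U" using that by (auto simp: U domain_below_def)
        have "\<not> 0 < Im (\<psi> w)"
        proof
          assume "0 < Im (\<psi> w)"
          then have "\<phi> (\<psi> w) \<in> U" unfolding bij(1)[symmetric] by blast
          then show False using \<phi>\<psi>[OF w] \<open>w \<notin> U\<close> by simp
        qed
        then have "Im (\<psi> w) = 0" using \<phi>\<psi>[OF w] by simp
        then obtain x where x: "\<psi> w = of_real x" by (metis complex_is_Real_iff Reals_cases)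
        have "w \<notin> \<Gamma>" using that by (auto simp: \<Gamma> graph_curve_def)
        have "x \<notin> {0..1}"
        proof
          assume "x \<in> {0..1}"
          then have "\<phi> (of_real x) \<in> \<Gamma>" unfolding bij(2)[symmetric] by blast
          then show False using \<phi>\<psi>[OF w] \<open>w \<notin> \<Gamma>\<close> x by simp
        qed
        then have "half_disc_map (\<psi> w) \<in> \<real>" unfolding x by (rule half_disc_map_real)
        then have "cnj (h w) = h w"
          unfolding h_def using q by (simp add: poly_cnj_real Reals_cnj_iff)
        then show ?thesis by (simp add: Reals_cnj_iff)
      qed
      \<comment> \<open>The half-disc map takes values in the closed unit disc, so a bound for
        \<open>q\<close> there bounds \<open>h\<close> on the unbounded domain.\<close>
      have "bounded (poly q ` cball 0 1)"
        by (intro compact_imp_bounded compact_continuous_image continuous_intros) simp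
      then obtain C where "\<forall>w\<in>poly q ` cball 0 1. cmod w \<le> C"
        unfolding bounded_iff by blast
      then have C: "cmod (poly q u) \<le> C" if "cmod u \<le> 1" for u using that by auto
      have hC: "cmod (h w) \<le> C" if "w \<in> closure U" for w
        unfolding h_def using \<phi>\<psi>[OF that] by (intro C norm_half_disc_map_le_1) simp
      have near: "\<bar>f w - Re (h w)\<bar> \<le> e" if "w \<in> \<Gamma>" for w
      proof -
        obtain x where x: "x \<in> {0..1}" "w = \<phi> (of_real x)" using \<open>w \<in> \<Gamma>\<close> \<Gamma>' by auto
        \<comment> \<open>The solution of (1 - cos \<theta>) / 2 = x in [0, pi].\<close>
        define \<theta> where "\<theta> = arccos (1 - 2 * x)"
        have \<theta>: "0 \<le> \<theta>" "\<theta> \<le> pi" "(1 - cos \<theta>) / 2 = x"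
          using x(1) arccos_bounded[of "1 - 2 * x"] by (auto simp: \<theta>_def)
        have "h w = poly q (half_disc_map (of_real ((1 - cos \<theta>) / 2)))"
          unfolding \<theta>(3) using \<psi>\<phi>[of "of_real x"] x by (simp add: h_def)
        then have "h w = poly q (cis \<theta>)" using half_disc_map_circle[OF \<theta>(1,2)] by simp
        then show ?thesis using fq[of \<theta>] unfolding \<theta>(3) x(2) by simp
      qed
      have int: "\<bar>?I - Re (coeff q 0)\<bar> \<le> e"
      proof -
        have i1: "(\<lambda>\<theta>. ?f ((1 - cos \<theta>) / 2)) integrable_on {0..pi}"
          by (intro integrable_continuous_real continuous_on_compose2[OF fc]) (auto intro!: continuous_intros)
        note i2 = integral_poly_cis[OF q]
        \<comment> \<open>Both terms are integrals over [0, pi]: the first by the change of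
          variables for the arcsine law, the second by the mean value property.\<close>
        have "pi * ?I - pi * Re (coeff q 0) =
            integral {0..pi} (\<lambda>\<theta>. ?f ((1 - cos \<theta>) / 2) - Re (poly q (cis \<theta>)))"
          using integral_harmonic_measure_infinity(1)[OF \<phi>01 \<Gamma>' f] i1 i2
          by (simp add: integral_diff has_integral_integrable integral_unique)
        also have "norm \<dots> \<le> integral {0..pi} (\<lambda>\<theta>. e)"
        proof (rule integral_norm_bound_integral)
          show "(\<lambda>\<theta>. ?f ((1 - cos \<theta>) / 2) - Re (poly q (cis \<theta>))) integrable_on {0..pi}"
            using i1 i2 by (intro integrable_diff) auto
        qed (use fq less_imp_le in auto)
        finally have "pi * \<bar>?I - Re (coeff q 0)\<bar> \<le> pi * e"
          by (simp add: abs_mult flip: right_diff_distrib)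
        then show ?thesis by simp
      qed
      have "((\<lambda>z. Re (h z)) \<longlongrightarrow> Re (coeff q 0)) ?F"
        unfolding h_def poly_0_coeff_0[symmetric]
        by (intro tendsto_Re isCont_tendsto_compose[OF poly_isCont s_lim])
      then have "eventually (\<lambda>z. dist (Re (h z)) (Re (coeff q 0)) < e) ?F" using e by (rule tendstoD)
      with inU show "eventually (\<lambda>z. dist (\<integral>x. f x \<partial>hitting_distribution (M z) (B z) \<Gamma>) ?I < \<epsilon>) ?F"
      proof eventually_elim
        case (elim z)
        have "\<bar>(\<integral>x. f x \<partial>hitting_distribution (M z) (B z) \<Gamma>) - Re (h z)\<bar> \<le> e"
          unfolding \<Gamma>
          by (rule hitting_distribution_integral_near[where C = C])
             (use assms(10)[OF elim(1)] elim(1) \<gamma> h_cont h_hol h_real hC f near in \<open>simp_all add: U \<Gamma>\<close>)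
        then show ?case using elim(2) int e unfolding dist_real_def e_def by linarith
      qed
    qed
  qed
qed

end
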